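(* Let $f,g$ be connected graphic functions with values in a commutative ring $\mathsf{k}$. Then the Young generating function of their product $f*g$ is the composition, with respect to the variable $z$, of their Young generating functions: $$F_{\mathsf{Y}}(f*g)(z)=F_{\mathsf{Y}}(f)\bigl(F_{\mathsf{Y}}(g)(z)\bigr).$$
   Context: All graphs are finite, undirected and simple (no loops, no multiple edges). A tube of a graph $\Gamma$ is a non-empty subset $G\subset V_\Gamma$ such that the induced subgraph $\Gamma|_G$ is connected. A partition $I\vdash\Gamma$ is a set partition of $V_\Gamma$ all of whose blocks are tubes. The contracted graph $\Gamma/I$ has the blocks of $I$ as vertices, two distinct blocks being adjacent iff their union is a tube of $\Gamma$. $\mathsf{P}_1$ is the one-vertex graph. A graphic function with values in a commutative ring $\mathsf{k}$ is a function on non-empty connected graphs with values in $\mathsf{k}$ which is constant on isomorphism classes. It is connected if $f(\mathsf{P}_1)=1$. The product of graphic functions is $$(f*g)(\Gamma)=\sum_{I\vdash\Gamma}f(\Gamma/I)\prod_{G\in I}g(\Gamma|_G).$$ For an integer partition $\lambda=(\lambda_1\ge\lambda_2\ge\dots\ge\lambda_k)$, $|\lambda|=\sum\lambda_i$, $l(\lambda)$ is the number of non-zero parts, $\lambda!=\lambda_1!\lambda_2!\cdots\lambda_k!$, and $\mathsf{K}_\lambda$ is the complete multipartite graph whose independent blocks have sizes $\lambda_1,\dots,\lambda_k$ (two vertices are adjacent iff they lie in different blocks). $(1^n)\cup\lambda$ is the partition obtained from $\lambda$ by adding $n$ parts equal to $1$. $m_\lambda$ is the monomial symmetric function in variables $x_1,x_2,\dots$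 and $\Lambda_{\mathbb Q}$ is the ring of symmetric functions over $\mathbb{Q}$. The Young generating function of $f$ is the formal power series in $z$ with (possibly infinite, degreewise finite) symmetric-function coefficients in $\mathsf{k}\otimes\Lambda_{\mathbb Q}$: $$F_{\mathsf{Y}}(f)(z)=\sum_{l(\lambda)\ge2}f(\mathsf{K}_\lambda)\frac{m_\lambda}{\lambda!}+\sum_{n\ge1,\ |\lambda|\ge0}f(\mathsf{K}_{(1^n)\cup\lambda})\frac{m_\lambda}{\lambda!}\frac{z^n}{n!}.$$ In the composition only the variable $z$ is substituted; the variables $x_i$ are kept fixed. *)

theory Defs
  imports
    "HOL-Library.Poly_Mapping"
    "HOL-Library.Disjoint_Sets"
    "HOL-Library.Multiset"
    "HOL-Computational_Algebra.Formal_Power_Series"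
    "Graph_Theory.Digraph_Isomorphism"
begin

text \<open>
  The sort \<open>{comm_ring, comm_monoid_mult}\<close> used throughout is that of commutative rings with unit,
  the zero ring included. The class \<^class>\<open>comm_ring_1\<close> would exclude the zero ring, but \<open>k \<otimes> \<rat>\<close> is
  zero as soon as the ring \<open>k\<close> has positive characteristic.
\<close>


section \<open>Graphs\<close>

text \<open>
  A finite simple graph is a \<^locale>\<open>pair_graph\<close>: a finite, loop-free digraph without parallel arcs
  whose set of arcs is symmetric. The library notion of connectedness includes non-emptiness.
\<close>

definition connected_graph :: "'a pair_pre_digraph \<Rightarrow> bool" where
  "connected_graph \<Gamma> \<longleftrightarrow> pair_graph \<Gamma> \<and> Digraph_Component.connected (with_proj \<Gamma>)"

definition graph_iso :: "'a pair_pre_digraph \<Rightarrow> 'b pair_pre_digraph \<Rightarrow> bool" where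
  "graph_iso \<Gamma> \<Delta> \<longleftrightarrow> digraph_iso (with_proj \<Gamma>) (with_proj \<Delta>)"

definition induced :: "'a pair_pre_digraph \<Rightarrow> 'a set \<Rightarrow> 'a pair_pre_digraph" where
  "induced \<Gamma> W = \<lparr>pverts = W, parcs = {(u, v) \<in> parcs \<Gamma>. u \<in> W \<and> v \<in> W}\<rparr>"

lemma with_proj_induced: "with_proj (induced \<Gamma> W) = with_proj \<Gamma> \<restriction> W"
  by (auto simp: induced_def with_proj_def induce_subgraph_def)

definition tube :: "'a pair_pre_digraph \<Rightarrow> 'a set \<Rightarrow> bool" where
  "tube \<Gamma> W \<longleftrightarrow> W \<noteq> {} \<and> W \<subseteq> pverts \<Gamma> \<and> Digraph_Component.connected (with_proj (induced \<Gamma> W))"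

definition tube_partition :: "'a pair_pre_digraph \<Rightarrow> 'a set set \<Rightarrow> bool" where
  "tube_partition \<Gamma> I \<longleftrightarrow> partition_on (pverts \<Gamma>) I \<and> (\<forall>W\<in>I. tube \<Gamma> W)"

definition contraction :: "'a pair_pre_digraph \<Rightarrow> 'a set set \<Rightarrow> 'a set pair_pre_digraph" where
  "contraction \<Gamma> I =
     \<lparr>pverts = I, parcs = {(A, B). A \<in> I \<and> B \<in> I \<and> A \<noteq> B \<and> tube \<Gamma> (A \<union> B)}\<rparr>"

definition single_vertex_graph :: "nat pair_pre_digraph" where
  "single_vertex_graph = \<lparr>pverts = {0}, parcs = {}\<rparr>"

text \<open>The vertex \<open>(i, j)\<close> is the \<open>j\<close>-th vertex of the \<open>i\<close>-th independent block.\<close>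

definition complete_multipartite :: "nat list \<Rightarrow> (nat \<times> nat) pair_pre_digraph" where
  "complete_multipartite \<mu> = (let V = {(i, j). i < length \<mu> \<and> j < \<mu> ! i} in
     \<lparr>pverts = V, parcs = {(u, v). u \<in> V \<and> v \<in> V \<and> fst u \<noteq> fst v}\<rparr>)"


section \<open>Graphic functions\<close>

text \<open>
  Every finite graph is isomorphic to one whose vertices are natural numbers. So a graphic function
  is given by its values on these graphs; its value on a graph over an arbitrary vertex type is
  obtained by transport along any isomorphism. Values on graphs that are not connected are
  irrelevant.
\<close>

definition graphic :: "(nat pair_pre_digraph \<Rightarrow> 'k) \<Rightarrow> bool" where
  "graphic f \<longleftrightarrow>
     (\<forall>\<Gamma> \<Delta>. connected_graph \<Gamma> \<and> connected_graph \<Delta> \<and> graph_iso \<Gamma> \<Delta> \<longrightarrow> f \<Gamma> = f \<Delta>)"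

definition gval :: "(nat pair_pre_digraph \<Rightarrow> 'k) \<Rightarrow> 'a pair_pre_digraph \<Rightarrow> 'k" where
  "gval f \<Gamma> = f (SOME \<Delta>. graph_iso \<Gamma> \<Delta>)"

definition connected_graphic :: "(nat pair_pre_digraph \<Rightarrow> 'k::one) \<Rightarrow> bool" where
  "connected_graphic f \<longleftrightarrow> graphic f \<and> f single_vertex_graph = 1"

definition graphic_prod ::
  "(nat pair_pre_digraph \<Rightarrow> 'k) \<Rightarrow> (nat pair_pre_digraph \<Rightarrow> 'k) \<Rightarrow>
   nat pair_pre_digraph \<Rightarrow> 'k::{comm_ring, comm_monoid_mult}" where
  "graphic_prod f g \<Gamma> =
     (\<Sum>I | tube_partition \<Gamma> I. gval f (contraction \<Gamma> I) * (\<Prod>W\<in>I. g (induced \<Gamma> W)))"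

lemma graph_iso_bij:
  assumes "pair_graph \<Gamma>"
  shows "graph_iso \<Gamma> \<Delta> \<longleftrightarrow>
    (\<exists>\<phi>. bij_betw \<phi> (pverts \<Gamma>) (pverts \<Delta>) \<and> parcs \<Delta> = map_prod \<phi> \<phi> ` parcs \<Gamma>)"
proof
  interpret pair_graph \<Gamma> by fact
  assume "graph_iso \<Gamma> \<Delta>"
  then obtain h where h: "digraph_isomorphism h" "with_proj \<Delta> = app_iso h (with_proj \<Gamma>)"
    unfolding graph_iso_def digraph_iso_def by blast
  let ?\<phi> = "iso_verts h"
  have th: "iso_tail h = fst" "iso_head h = snd"
    using h(2) by (simp_all add: with_proj_def app_iso_def)
  have V: "pverts \<Delta> = ?\<phi> ` pverts \<Gamma>" and A: "parcs \<Delta> = iso_arcs h ` parcs \<Gamma>"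
    using h(2) by (simp_all add: with_proj_def app_iso_def)
  have "iso_arcs h a = map_prod ?\<phi> ?\<phi> a" if "a \<in> parcs \<Gamma>" for a
    using h(1) that unfolding digraph_isomorphism_def th
    by (auto intro!: prod_eqI)
  then have "parcs \<Delta> = map_prod ?\<phi> ?\<phi> ` parcs \<Gamma>" using A by auto
  moreover have "bij_betw ?\<phi> (pverts \<Gamma>) (pverts \<Delta>)"
    using h(1) V unfolding digraph_isomorphism_def bij_betw_def by simp
  ultimately show "\<exists>\<phi>. bij_betw \<phi> (pverts \<Gamma>) (pverts \<Delta>) \<and> parcs \<Delta> = map_prod \<phi> \<phi> ` parcs \<Gamma>"
    by blast
next
  interpret pair_graph \<Gamma> by fact
  assume "\<exists>\<phi>. bij_betw \<phi> (pverts \<Gamma>) (pverts \<Delta>) \<and> parcs \<Delta> = map_prod \<phi> \<phi> ` parcs \<Gamma>"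
  then obtain \<phi> where bij: "bij_betw \<phi> (pverts \<Gamma>) (pverts \<Delta>)"
    and A: "parcs \<Delta> = map_prod \<phi> \<phi> ` parcs \<Gamma>" by blast
  define h where "h = \<lparr>iso_verts = \<phi>, iso_arcs = map_prod \<phi> \<phi>, iso_head = snd, iso_tail = fst\<rparr>"
  have inj: "inj_on \<phi> (pverts \<Gamma>)" using bij by (simp add: bij_betw_def)
  have "inj_on (map_prod \<phi> \<phi>) (pverts \<Gamma> \<times> pverts \<Gamma>)"
    using inj by (auto simp: inj_on_def)
  moreover have "parcs \<Gamma> \<subseteq> pverts \<Gamma> \<times> pverts \<Gamma>"
    using in_arcsD1 in_arcsD2 by auto
  ultimately have "inj_on (map_prod \<phi> \<phi>) (parcs \<Gamma>)" by (rule inj_on_subset)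
  with inj have "digraph_isomorphism h"
    unfolding digraph_isomorphism_def h_def by (auto intro: wf_digraph_axioms)
  moreover have "with_proj \<Delta> = app_iso h (with_proj \<Gamma>)"
    using bij A by (simp add: with_proj_def app_iso_def h_def bij_betw_def)
  ultimately show "graph_iso \<Gamma> \<Delta>" unfolding graph_iso_def digraph_iso_def by blast
qed

lemma ex_nat_copy:
  assumes "pair_graph \<Gamma>"
  shows "\<exists>\<Delta> :: nat pair_pre_digraph. graph_iso \<Gamma> \<Delta>"
proof -
  interpret pair_graph \<Gamma> by fact
  obtain \<phi> where "bij_betw \<phi> (pverts \<Gamma>) {0..<card (pverts \<Gamma>)}"
    using ex_bij_betw_finite_nat[OF pair_finite_verts] by blast
  then have "graph_iso \<Gamma> \<lparr>pverts = {0..<card (pverts \<Gamma>)}, parcs = map_prod \<phi> \<phi> ` parcs \<Gamma>\<rparr>"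
    unfolding graph_iso_bij[OF assms] by auto
  then show ?thesis by blast
qed


section \<open>The ring \<open>k \<otimes> \<rat>\<close>\<close>

text \<open>
  \<open>k \<otimes> \<rat>\<close> is the localisation of \<open>k\<close> at the positive integers. The pair \<open>(a, n)\<close> stands for
  \<open>a \<otimes> 1/n\<close>, and two fractions are equal iff they agree up to integer torsion. As there is no
  \<^const>\<open>of_nat\<close> for the sort at hand, integer multiples are written as iterated sums.
\<close>

definition nmult :: "nat \<Rightarrow> 'a::comm_monoid_add \<Rightarrow> 'a" where
  "nmult n a = (\<Sum>i<n. a)"

lemma nmult_0 [simp]: "nmult 0 a = 0" "nmult n 0 = 0"
  by (simp_all add: nmult_def)

lemma nmult_1 [simp]: "nmult 1 a = a" "nmult (Suc 0) a = a"
  by (simp_all add: nmult_def)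

lemma nmult_Suc: "nmult (Suc n) a = nmult n a + a"
  by (simp add: nmult_def)

lemma nmult_add: "nmult n (a + b) = nmult n a + nmult n b"
  by (simp add: nmult_def sum.distrib)

lemma nmult_add_left: "nmult (m + n) a = nmult m a + nmult n a"
  by (induction n) (simp_all add: nmult_Suc add.assoc)

lemma nmult_nmult: "nmult m (nmult n a) = nmult (m * n) a"
  by (induction m) (simp_all add: nmult_Suc nmult_add_left add.commute)

lemma nmult_mult_left: "nmult n a * b = nmult n (a * b)" for a :: "'a::comm_ring"
  by (simp add: nmult_def sum_distrib_right)

lemma nmult_mult_right: "a * nmult n b = nmult n (a * b)" for a :: "'a::comm_ring"
  by (simp add: nmult_def sum_distrib_left)

lemma nmult_minus: "nmult n (- a) = - nmult n a" for a :: "'a::comm_ring"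
  by (simp add: nmult_def sum_negf)

definition qrel ::
  "'a::{comm_ring, comm_monoid_mult} \<times> nat \<Rightarrow> 'a \<times> nat \<Rightarrow> bool" where
  "qrel = (\<lambda>(a, m) (b, n). m > 0 \<and> n > 0 \<and> (\<exists>c>0. nmult (c * n) a = nmult (c * m) b))"

lemma qrel_refl: "n > 0 \<Longrightarrow> qrel (a, n) (a, n)"
  by (auto simp: qrel_def)

lemma qrel_iff:
  "qrel (a, m) (b, n) \<longleftrightarrow> m > 0 \<and> n > 0 \<and> (\<exists>c>0. nmult (c * n) a = nmult (c * m) b)"
  by (simp add: qrel_def)

lemma part_equivp_qrel: "part_equivp qrel"
proof (rule part_equivpI)
  have "qrel (1, 1) (1 :: 'a, 1)" by (rule qrel_refl) simp
  then show "\<exists>x :: 'a \<times> nat. qrel x x" by blast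
  show "symp (qrel :: 'a \<times> nat \<Rightarrow> _)"
    by (auto simp: symp_def qrel_def)
  show "transp (qrel :: 'a \<times> nat \<Rightarrow> _)"
  proof (rule transpI, clarify)
    fix a b e :: 'a and m n p :: nat
    assume "qrel (a, m) (b, n)" "qrel (b, n) (e, p)"
    then obtain c d where pos: "m > 0" "n > 0" "p > 0" "c > 0" "d > 0"
      and c: "nmult (c * n) a = nmult (c * m) b" and d: "nmult (d * p) b = nmult (d * n) e"
      unfolding qrel_iff by blast
    have "nmult ((c * d * n) * p) a = nmult (d * p) (nmult (c * n) a)"
      by (simp add: nmult_nmult ac_simps)
    also have "\<dots> = nmult (c * m) (nmult (d * p) b)"
      by (simp add: c nmult_nmult ac_simps)
    also have "\<dots> = nmult ((c * d * n) * m) e"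
      by (simp add: d nmult_nmult ac_simps)
    finally have "nmult ((c * d * n) * p) a = nmult ((c * d * n) * m) e" .
    moreover have "c * d * n > 0" using pos by simp
    ultimately show "qrel (a, m) (e, p)" using pos unfolding qrel_iff by blast
  qed
qed

quotient_type (overloaded) 'a rationalized =
  "'a::{comm_ring, comm_monoid_mult} \<times> nat" / partial: "qrel"
  by (rule part_equivp_qrel)

text \<open>\<open>qfrac a n\<close> is \<open>a \<otimes> 1/n\<close>, with the convention that it is \<open>0\<close> for \<open>n = 0\<close>.\<close>

lift_definition qfrac :: "'a::{comm_ring, comm_monoid_mult} \<Rightarrow> nat \<Rightarrow> 'a rationalized"
  is "\<lambda>a n. if n = 0 then (0, 1) else (a, n)"
  by (simp add: qrel_refl)

instantiation rationalized :: ("{comm_ring, comm_monoid_mult}") "{comm_ring, comm_monoid_mult}"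
begin

lift_definition zero_rationalized :: "'a rationalized" is "(0, 1)"
  by (simp add: qrel_refl)

lift_definition one_rationalized :: "'a rationalized" is "(1, 1)"
  by (simp add: qrel_refl)

lift_definition plus_rationalized :: "'a rationalized \<Rightarrow> 'a rationalized \<Rightarrow> 'a rationalized"
  is "\<lambda>(a, m) (b, n). (nmult n a + nmult m b, m * n)"
proof clarify
  fix a a' b b' :: 'a and m m' n n' :: nat
  assume "qrel (a, m) (a', m')" "qrel (b, n) (b', n')"
  then obtain c d where pos: "m > 0" "m' > 0" "n > 0" "n' > 0" "c > 0" "d > 0"
    and c: "nmult (c * m') a = nmult (c * m) a'" and d: "nmult (d * n') b = nmult (d * n) b'"
    unfolding qrel_iff by blast
  have "nmult ((c * d) * (m' * n')) (nmult n a + nmult m b) =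
      nmult (d * n * n') (nmult (c * m') a) + nmult (c * m * m') (nmult (d * n') b)"
    by (simp add: nmult_add nmult_nmult ac_simps)
  also have "\<dots> = nmult ((c * d) * (m * n)) (nmult n' a' + nmult m' b')"
    unfolding c d by (simp add: nmult_add nmult_nmult ac_simps)
  finally show "qrel (nmult n a + nmult m b, m * n) (nmult n' a' + nmult m' b', m' * n')"
    using pos unfolding qrel_iff by (metis nat_0_less_mult_iff)
qed

lift_definition uminus_rationalized :: "'a rationalized \<Rightarrow> 'a rationalized"
  is "\<lambda>(a, m). (- a, m)"
  by (auto simp: qrel_iff nmult_minus)

definition minus_rationalized :: "'a rationalized \<Rightarrow> 'a rationalized \<Rightarrow> 'a rationalized" where
  "x - y = x + - y" for x :: "'a rationalized"

lift_definition times_rationalized :: "'a rationalized \<Rightarrow> 'a rationalized \<Rightarrow> 'a rationalized"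
  is "\<lambda>(a, m) (b, n). (a * b, m * n)"
proof clarify
  fix a a' b b' :: 'a and m m' n n' :: nat
  assume "qrel (a, m) (a', m')" "qrel (b, n) (b', n')"
  then obtain c d where pos: "m > 0" "m' > 0" "n > 0" "n' > 0" "c > 0" "d > 0"
    and c: "nmult (c * m') a = nmult (c * m) a'" and d: "nmult (d * n') b = nmult (d * n) b'"
    unfolding qrel_iff by blast
  have "nmult ((c * d) * (m' * n')) (a * b) = nmult (c * m') a * nmult (d * n') b"
    by (simp add: nmult_mult_left nmult_mult_right nmult_nmult ac_simps)
  also have "\<dots> = nmult ((c * d) * (m * n)) (a' * b')"
    unfolding c d by (simp add: nmult_mult_left nmult_mult_right nmult_nmult ac_simps)
  finally show "qrel (a * b, m * n) (a' * b', m' * n')"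
    using pos unfolding qrel_iff by (metis nat_0_less_mult_iff)
qed

lemma qrelI: "m > 0 \<Longrightarrow> n > 0 \<Longrightarrow> nmult n a = nmult m b \<Longrightarrow> qrel (a, m) (b, n)"
  unfolding qrel_iff by (intro conjI exI[of _ 1]) auto

lemma qrel_pos: "qrel (a, m) (a, m) \<Longrightarrow> m > 0"
  by (simp add: qrel_iff)

instance
proof
  fix x y z :: "'a rationalized"
  show "x + y + z = x + (y + z)"
    by transfer (auto intro!: qrelI dest!: qrel_pos simp: nmult_add nmult_nmult ac_simps)
  show "x + y = y + x"
    by transfer (auto intro!: qrelI dest!: qrel_pos simp: nmult_add nmult_nmult ac_simps)
  show "0 + x = x"
    by transfer (auto intro!: qrelI dest!: qrel_pos)
  show "- x + x = 0"
    by transfer (auto intro!: qrelI dest!: qrel_pos simp: nmult_minus)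
  show "x - y = x + - y"
    by (rule minus_rationalized_def)
  show "x * y * z = x * (y * z)"
    by transfer (auto intro!: qrelI dest!: qrel_pos simp: ac_simps)
  show "x * y = y * x"
    by transfer (auto intro!: qrelI dest!: qrel_pos simp: ac_simps)
  show "1 * x = x"
    by transfer (auto intro!: qrelI dest!: qrel_pos)
  show "(x + y) * z = x * z + y * z"
    by transfer (auto intro!: qrelI dest!: qrel_pos
        simp: distrib_left distrib_right nmult_add nmult_nmult nmult_mult_left nmult_mult_right ac_simps)
qed

end

lemma qfrac_eq_iff:
  assumes "m > 0" "n > 0"
  shows "qfrac a m = qfrac b n \<longleftrightarrow> (\<exists>c>0. nmult (c * n) a = nmult (c * m) b)"
  using assms by transfer (simp add: qrel_iff)

lemma qfrac_add: "m > 0 \<Longrightarrow> n > 0 \<Longrightarrow> qfrac a m + qfrac b n = qfrac (nmult n a + nmult m b) (m * n)"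
  by transfer (simp add: qrel_refl)

lemma qfrac_mult: "m > 0 \<Longrightarrow> n > 0 \<Longrightarrow> qfrac a m * qfrac b n = qfrac (a * b) (m * n)"
  by transfer (simp add: qrel_refl)

lemma qfrac_one: "qfrac 1 1 = 1"
  by transfer (simp add: qrel_refl)


section \<open>Power series in \<open>x\<^sub>0, x\<^sub>1, \<dots>\<close>\<close>

text \<open>
  A monomial is its exponent vector \<open>\<alpha> :: nat \<Rightarrow>\<^sub>0 nat\<close>. Symmetric functions, and their possibly
  infinite but degreewise finite sums, are power series in the variables \<open>x\<^sub>i\<close>.
\<close>

typedef 'r xseries = "UNIV :: ((nat \<Rightarrow>\<^sub>0 nat) \<Rightarrow> 'r) set"
  morphisms xcoeff Xseries ..

setup_lifting type_definition_xseries

lemma xseries_eqI: "(\<And>\<alpha>. xcoeff F \<alpha> = xcoeff G \<alpha>) \<Longrightarrow> F = G"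
  by (simp add: xcoeff_inject[symmetric] fun_eq_iff)

lemma xcoeff_Xseries [simp]: "xcoeff (Xseries u) = u"
  by (simp add: Xseries_inverse)

definition splits :: "(nat \<Rightarrow>\<^sub>0 nat) \<Rightarrow> ((nat \<Rightarrow>\<^sub>0 nat) \<times> (nat \<Rightarrow>\<^sub>0 nat)) set" where
  "splits \<alpha> = {(\<beta>, \<gamma>). \<beta> + \<gamma> = \<alpha>}"

lemma finite_splits [simp]: "finite (splits \<alpha>)"
proof -
  let ?B = "{\<beta>. \<forall>i. Poly_Mapping.lookup \<beta> i \<le> Poly_Mapping.lookup \<alpha> i}"
  have "inj_on (\<lambda>\<beta>. restrict (Poly_Mapping.lookup \<beta>) (Poly_Mapping.keys \<alpha>)) ?B"
  proof (rule inj_onI)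
    fix \<beta> \<gamma> assume B: "\<beta> \<in> ?B" "\<gamma> \<in> ?B"
      and eq: "restrict (Poly_Mapping.lookup \<beta>) (Poly_Mapping.keys \<alpha>) = restrict (Poly_Mapping.lookup \<gamma>) (Poly_Mapping.keys \<alpha>)"
    show "\<beta> = \<gamma>"
    proof (rule poly_mapping_eqI)
      fix i show "Poly_Mapping.lookup \<beta> i = Poly_Mapping.lookup \<gamma> i"
      proof (cases "i \<in> Poly_Mapping.keys \<alpha>")
        case True
        then show ?thesis using fun_cong[OF eq, of i] by simp
      next
        case False
        then have "Poly_Mapping.lookup \<alpha> i = 0" by (simp add: in_keys_iff)
        then have "Poly_Mapping.lookup \<beta> i \<le> 0" "Poly_Mapping.lookup \<gamma> i \<le> 0" using B by (metis mem_Collect_eq)+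
        then show ?thesis by simp
      qed
    qed
  qed
  moreover have "finite (PiE (Poly_Mapping.keys \<alpha>) (\<lambda>i. {..Poly_Mapping.lookup \<alpha> i}))"
    by (intro finite_PiE) auto
  moreover have "(\<lambda>\<beta>. restrict (Poly_Mapping.lookup \<beta>) (Poly_Mapping.keys \<alpha>)) ` ?B \<subseteq> PiE (Poly_Mapping.keys \<alpha>) (\<lambda>i. {..Poly_Mapping.lookup \<alpha> i})"
    by auto
  ultimately have "finite ?B" by (meson finite_imageD finite_subset)
  then have "finite (?B \<times> ?B)" by simp
  moreover have "splits \<alpha> \<subseteq> ?B \<times> ?B"
    by (auto simp: splits_def lookup_add)
  ultimately show ?thesis by (rule finite_subset[rotated])
qed

instantiation xseries :: ("{comm_ring, comm_monoid_mult}") "{comm_ring, comm_monoid_mult}"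
begin

lift_definition zero_xseries :: "'a xseries" is "\<lambda>_. 0" .
lift_definition one_xseries :: "'a xseries" is "\<lambda>\<alpha>. if \<alpha> = 0 then 1 else 0" .
lift_definition plus_xseries :: "'a xseries \<Rightarrow> 'a xseries \<Rightarrow> 'a xseries"
  is "\<lambda>F G \<alpha>. F \<alpha> + G \<alpha>" .
lift_definition uminus_xseries :: "'a xseries \<Rightarrow> 'a xseries" is "\<lambda>F \<alpha>. - F \<alpha>" .
lift_definition minus_xseries :: "'a xseries \<Rightarrow> 'a xseries \<Rightarrow> 'a xseries"
  is "\<lambda>F G \<alpha>. F \<alpha> - G \<alpha>" .
lift_definition times_xseries :: "'a xseries \<Rightarrow> 'a xseries \<Rightarrow> 'a xseries"
  is "\<lambda>F G \<alpha>. \<Sum>(\<beta>, \<gamma>)\<in>splits \<alpha>. F \<beta> * G \<gamma>" .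

instance
proof
  fix F G H :: "'a xseries"
  show "F + G + H = F + (G + H)" by transfer (simp add: add.assoc)
  show "F + G = G + F" by transfer (simp add: add.commute)
  show "0 + F = F" by transfer simp
  show "- F + F = 0" by transfer simp
  show "F - G = F + - G" by transfer simp
  show "F * G = G * F"
  proof (rule xseries_eqI, simp add: times_xseries.rep_eq)
    fix \<alpha>
    show "(\<Sum>(\<beta>, \<gamma>)\<in>splits \<alpha>. xcoeff F \<beta> * xcoeff G \<gamma>) =
      (\<Sum>(\<beta>, \<gamma>)\<in>splits \<alpha>. xcoeff G \<beta> * xcoeff F \<gamma>)"
      by (rule sum.reindex_bij_witness[of _ prod.swap prod.swap])
        (auto simp: splits_def add.commute mult.commute)
  qed
  show "(F + G) * H = F * H + G * H"
    by (rule xseries_eqI)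
      (simp add: times_xseries.rep_eq plus_xseries.rep_eq distrib_right sum.distrib case_prod_unfold)
  show "1 * F = F"
  proof (rule xseries_eqI)
    fix \<alpha>
    have "xcoeff (1 * F) \<alpha> =
        (\<Sum>p\<in>splits \<alpha>. if p = (0, \<alpha>) then xcoeff F \<alpha> else 0)"
      unfolding times_xseries.rep_eq one_xseries.rep_eq
      by (rule sum.cong) (auto simp: splits_def split: if_splits)
    also have "\<dots> = (if (0, \<alpha>) \<in> splits \<alpha> then xcoeff F \<alpha> else 0)"
      by (rule sum.delta) simp
    also have "\<dots> = xcoeff F \<alpha>"
      by (simp add: splits_def)
    finally show "xcoeff (1 * F) \<alpha> = xcoeff F \<alpha>" .
  qed
  show "F * G * H = F * (G * H)"
  proof (rule xseries_eqI)
    fix \<alpha>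
    have "xcoeff (F * G * H) \<alpha> =
        (\<Sum>((\<beta>, \<gamma>), (\<delta>, \<epsilon>))\<in>Sigma (splits \<alpha>) (\<lambda>(\<beta>, \<gamma>). splits \<beta>). xcoeff F \<delta> * xcoeff G \<epsilon> * xcoeff H \<gamma>)"
      unfolding times_xseries.rep_eq
      by (subst sum.Sigma[symmetric])
        (auto simp: sum_distrib_right case_prod_unfold)
    also have "\<dots> =
        (\<Sum>((\<beta>, \<gamma>), (\<delta>, \<epsilon>))\<in>Sigma (splits \<alpha>) (\<lambda>(\<beta>, \<gamma>). splits \<gamma>). xcoeff F \<beta> * (xcoeff G \<delta> * xcoeff H \<epsilon>))"
      by (rule sum.reindex_bij_witness[of _
            "\<lambda>((\<beta>, \<gamma>), (\<delta>, \<epsilon>)). ((\<beta> + \<delta>, \<epsilon>), (\<beta>, \<delta>))"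
            "\<lambda>((\<beta>, \<gamma>), (\<delta>, \<epsilon>)). ((\<delta>, \<epsilon> + \<gamma>), (\<epsilon>, \<gamma>))"])
        (auto simp: splits_def ac_simps)
    also have "\<dots> = xcoeff (F * (G * H)) \<alpha>"
      unfolding times_xseries.rep_eq
      by (subst sum.Sigma[symmetric])
        (auto simp: sum_distrib_left case_prod_unfold)
    finally show "xcoeff (F * G * H) \<alpha> = xcoeff (F * (G * H)) \<alpha>" .
  qed
qed

end

definition xscale :: "'r \<Rightarrow> 'r::times xseries \<Rightarrow> 'r xseries" where
  "xscale c F = Xseries (\<lambda>\<alpha>. c * xcoeff F \<alpha>)"

text \<open>
  The sum of a family of which only finitely many members have a non-zero coefficient at any given
  monomial.
\<close>

definition xsum :: "('i \<Rightarrow> 'r xseries) \<Rightarrow> 'i set \<Rightarrow> 'r::comm_monoid_add xseries" where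
  "xsum u A = Xseries (\<lambda>\<alpha>. \<Sum>i | i \<in> A \<and> xcoeff (u i) \<alpha> \<noteq> 0. xcoeff (u i) \<alpha>)"


section \<open>Integer partitions and monomial symmetric functions\<close>

definition partitions :: "nat list set" where
  "partitions = {\<mu>. sorted_wrt (\<ge>) \<mu> \<and> 0 \<notin> set \<mu>}"

definition fact_partition :: "nat list \<Rightarrow> nat" where
  "fact_partition \<mu> = (\<Prod>k\<leftarrow>\<mu>. fact k)"

text \<open>The sum of all distinct monomials whose non-zero exponents are the parts of \<open>\<mu>\<close>.\<close>

definition msym :: "nat list \<Rightarrow> 'r::{zero, one} xseries" where
  "msym \<mu> = Xseries (\<lambda>\<alpha>. if image_mset (Poly_Mapping.lookup \<alpha>) (mset_set (Poly_Mapping.keys \<alpha>)) = mset \<mu> then 1 else 0)"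


section \<open>The Young generating function\<close>

text \<open>
  Appending \<open>n\<close> parts equal to \<open>1\<close> to a partition yields \<open>(1\<^sup>n) \<union> \<mu>\<close> in decreasing order.
\<close>

definition young_gf ::
  "(nat pair_pre_digraph \<Rightarrow> 'k::{comm_ring, comm_monoid_mult}) \<Rightarrow> 'k rationalized xseries fps" where
  "young_gf f = Abs_fps (\<lambda>n.
     if n = 0 then
       xsum (\<lambda>\<mu>. xscale (qfrac (gval f (complete_multipartite \<mu>)) (fact_partition \<mu>)) (msym \<mu>))
         {\<mu> \<in> partitions. length \<mu> \<ge> 2}
     else
       xsum (\<lambda>\<mu>. xscale (qfrac (gval f (complete_multipartite (\<mu> @ replicate n 1)))
                               (fact_partition \<mu> * fact n)) (msym \<mu>))
         partitions)"


section \<open>Substitution for \<open>z\<close>\<close>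

text \<open>
  The library's powers of a \<^typ>\<open>'a fps\<close> require \<open>0 \<noteq> 1\<close> for the coefficients.
\<close>

primrec fps_pow :: "'a::{comm_ring, comm_monoid_mult} fps \<Rightarrow> nat \<Rightarrow> 'a fps" where
  "fps_pow G 0 = 1"
| "fps_pow G (Suc j) = G * fps_pow G j"

text \<open>
  \<open>F(G(z)) = \<Sum>\<^sub>j F\<^sub>j G(z)\<^sup>j\<close>. The series \<^const>\<open>fps_compose\<close> of the library truncates this sum, as it
  assumes that \<open>G\<close> has no term of degree \<open>0\<close> in \<open>z\<close>. Here it suffices that the term of degree \<open>0\<close>
  in \<open>z\<close> and all \<open>x\<^sub>i\<close> vanishes: only finitely many \<open>j\<close> then contribute to a given monomial.
\<close>

definition zsubst ::
  "'r::{comm_ring, comm_monoid_mult} xseries fps \<Rightarrow> 'r xseries fps \<Rightarrow> 'r xseries fps" where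
  "zsubst F G = Abs_fps (\<lambda>n. xsum (\<lambda>j. fps_nth (fps_const (fps_nth F j) * fps_pow G j) n) UNIV)"

definition mdegree :: "(nat \<Rightarrow>\<^sub>0 nat) \<Rightarrow> nat" where
  "mdegree \<alpha> = (\<Sum>i\<in>Poly_Mapping.keys \<alpha>. Poly_Mapping.lookup \<alpha> i)"

lemma mdegree_add: "mdegree (\<alpha> + \<beta>) = mdegree \<alpha> + mdegree \<beta>"
  unfolding mdegree_def by (rule setsum_keys_plus_distrib) simp_all

lemma mdegree_eq_0: "mdegree \<alpha> = 0 \<longleftrightarrow> \<alpha> = 0"
  by (auto simp: mdegree_def in_keys_iff poly_mapping_eq_iff fun_eq_iff)

lemma xcoeff_sum: "xcoeff (\<Sum>i\<in>A. u i) \<alpha> = (\<Sum>i\<in>A. xcoeff (u i) \<alpha>)"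
  by (induction A rule: infinite_finite_induct)
    (simp_all add: zero_xseries.rep_eq plus_xseries.rep_eq)

lemma fps_pow_vanishes:
  assumes "xcoeff (fps_nth G 0) 0 = 0" and "n + mdegree \<alpha> < j"
  shows "xcoeff (fps_nth (fps_pow G j) n) \<alpha> = 0"
  using assms(2)
proof (induction j arbitrary: n \<alpha>)
  case (Suc j)
  have "xcoeff (fps_nth G i) \<beta> * xcoeff (fps_nth (fps_pow G j) (n - i)) \<gamma> = 0"
    if "i \<le> n" "\<beta> + \<gamma> = \<alpha>" for i \<beta> \<gamma>
  proof (cases "i = 0 \<and> \<beta> = 0")
    case True
    then show ?thesis using assms(1) by simp
  next
    case False
    then have "i + mdegree \<beta> > 0" by (auto simp: mdegree_eq_0)
    moreover have "mdegree \<alpha> = mdegree \<beta> + mdegree \<gamma>"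
      using that(2) mdegree_add by metis
    ultimately have "(n - i) + mdegree \<gamma> < j" using Suc.prems that(1) by linarith
    then show ?thesis using Suc.IH by simp
  qed
  then show ?case
    by (auto simp: fps_mult_nth xcoeff_sum times_xseries.rep_eq splits_def intro!: sum.neutral)
qed simp

lemma finite_zsubst_terms:
  assumes "xcoeff (fps_nth G 0) 0 = 0"
  shows "finite {j. xcoeff (fps_nth (fps_const (fps_nth F j) * fps_pow G j) n) \<alpha> \<noteq> 0}"
proof (rule finite_subset)
  show "{j. xcoeff (fps_nth (fps_const (fps_nth F j) * fps_pow G j) n) \<alpha> \<noteq> 0} \<subseteq> {..n + mdegree \<alpha>}"
  proof (rule subsetI, rule ccontr)
    fix j
    assume "j \<in> {j. xcoeff (fps_nth (fps_const (fps_nth F j) * fps_pow G j) n) \<alpha> \<noteq> 0}"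
      and "j \<notin> {..n + mdegree \<alpha>}"
    then have j: "n + mdegree \<alpha> < j"
      and nz: "xcoeff (fps_nth F j * fps_nth (fps_pow G j) n) \<alpha> \<noteq> 0"
      by auto
    have "xcoeff (fps_nth (fps_pow G j) n) \<gamma> = 0" if "\<beta> + \<gamma> = \<alpha>" for \<beta> \<gamma>
      using that j mdegree_add[of \<beta> \<gamma>] by (intro fps_pow_vanishes assms) auto
    then have "xcoeff (fps_nth F j * fps_nth (fps_pow G j) n) \<alpha> = 0"
      by (auto simp: times_xseries.rep_eq splits_def intro!: sum.neutral)
    with nz show False by simp
  qed
qed simp

lemma young_gf_no_constant_term: "xcoeff (fps_nth (young_gf f) 0) 0 = 0"
  by (auto simp: young_gf_def xsum_def xscale_def msym_def intro!: sum.neutral)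

end

theory Submission
  imports Defs
begin

text \<open>
  Multiplied by the factorials of its exponents, the coefficient of a series at a monomial becomes a
  function of a set of vertices coloured by the variables; it is the constant term of an iterated
  derivative, so Leibniz' rule turns products of series into sums over subsets and the composition
  \<open>F(G(z))\<close> into a sum over a subset \<open>S\<close>, on which the \<open>x\<close>-part of \<open>F\<close> is evaluated, and
  a set partition \<open>P\<close> of its complement, each block of which carries a coefficient of \<open>G\<close>. In a
  complete multipartite graph, two disjoint tubes that are not both single vertices have adjacent images in
  the contraction. So a partition into tubes is the same as such a pair \<open>(S, P)\<close>, and the
  contracted graph is again complete multipartite, the blocks in \<open>P\<close> being new singleton exponent_partition.
\<close>

section \<open>Rational multiples\<close>

text \<open>Clearing the factorials is reversible because \<open>k\<close> tensored with the
  rationals has no torsion: multiplication by a positive integer is injective there, although the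
  map from \<open>k\<close> need not be. Series that agree on every coloured set are therefore
  equal, and no monomials have to be counted.

  Two features of the inner series decide the shape of the pairs. Its part free of \<open>z\<close>
  need not vanish, so a block that replaces \<open>z\<close> may contain only vertices coloured by
  \<open>x\<close> variables; just the constant term in all variables vanishes, which excludes empty
  blocks. A single vertex coloured \<open>x_i\<close>, however, gives no monomial of the inner
  series, since the part free of \<open>z\<close> has only partitions of length at least 2. Such a
  one-element block is left to the outer series, where it keeps its variable, and the inner function
  contributes its value 1 at the one-vertex graph. A single vertex coloured \<open>z\<close>, in
  contrast, is a genuine block in \<open>P\<close>.\<close>

lemma nmult_sum: "nmult n (sum u A) = (\<Sum>i\<in>A. nmult n (u i))"
  unfolding nmult_def by (rule sum.swap)

lemma nmult_qfrac:
  assumes "m > 0"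
  shows "nmult k (qfrac a m) = qfrac (nmult k a) m"
proof (induction k)
  case 0
  show ?case using assms by (simp, transfer) (simp add: qrel_iff, metis zero_less_one)
next
  case (Suc k)
  have "qfrac (nmult k a) m + qfrac a m = qfrac (nmult (Suc k) a) m"
    unfolding qfrac_add[OF assms assms] using assms
    by (subst qfrac_eq_iff)
      (auto intro!: exI[of _ 1] simp: nmult_add nmult_nmult nmult_Suc ac_simps)
  then show ?case by (simp add: nmult_Suc[of k "qfrac a m"] Suc)
qed

lemma qfrac_cases:
  obtains a m where "m > 0" "x = qfrac a m"
proof -
  have "\<exists>a m. m > 0 \<and> x = qfrac a m"
    by transfer (force simp: qrel_iff)
  with that show thesis by blast
qed

text \<open>Equality of fractions up to torsion lets the factor \<open>k\<close> be absorbed into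
  its witness. This is what finally divides the factorials out again.\<close>

lemma nmult_cancel_rationalized:
  fixes x y :: "'k::{comm_ring, comm_monoid_mult} rationalized"
  assumes "k > 0" and eq: "nmult k x = nmult k y"
  shows "x = y"
proof -
  obtain a m where x: "m > 0" "x = qfrac a m" by (rule qfrac_cases)
  obtain b n where y: "n > 0" "y = qfrac b n" by (rule qfrac_cases)
  from eq obtain c where "c > 0" "nmult (c * n) (nmult k a) = nmult (c * m) (nmult k b)"
    unfolding x y nmult_qfrac[OF x(1)] nmult_qfrac[OF y(1)] qfrac_eq_iff[OF x(1) y(1)] by blast
  then show ?thesis using assms(1)
    unfolding x y qfrac_eq_iff[OF x(1) y(1)]
    by (intro exI[of _ "c * k"]) (simp add: nmult_nmult ac_simps)
qed

lemma nmult_qfrac_cancel: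
  assumes "k > 0" "m > 0"
  shows "nmult k (qfrac a (k * m)) = qfrac a m"
  using assms by (simp add: nmult_qfrac qfrac_eq_iff nmult_nmult)
    (auto intro!: exI[of _ 1] simp: ac_simps)

text \<open>The canonical ring homomorphism from \<open>k\<close>; it identifies elements that
  differ by torsion.\<close>

abbreviation qemb :: "'k::{comm_ring, comm_monoid_mult} \<Rightarrow> 'k rationalized" where
  "qemb a \<equiv> qfrac a 1"

lemma qemb_0: "qemb 0 = 0"
  by transfer (simp add: qrel_refl)

lemma qemb_mult: "qemb (a * b) = qemb a * qemb b"
  by (simp add: qfrac_mult)

lemma qemb_add: "qemb (a + b) = qemb a + qemb b"
  by (simp add: qfrac_add)

lemma qemb_sum: "qemb (sum u A) = (\<Sum>i\<in>A. qemb (u i))"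
proof (cases "finite A")
  case True
  then show ?thesis
    by (induction A rule: finite_induct) (metis sum.empty qemb_0, metis sum.insert qemb_add)
qed (metis sum.infinite qemb_0)

lemma qemb_prod: "qemb (prod u A) = (\<Prod>i\<in>A. qemb (u i))"
proof (cases "finite A")
  case True
  then show ?thesis
    by (induction A rule: finite_induct) (metis prod.empty qfrac_one, metis prod.insert qemb_mult)
qed (metis prod.infinite qfrac_one)

section \<open>Labelled coefficients\<close>

lemma xcoeff_nmult: "xcoeff (nmult n F) \<alpha> = nmult n (xcoeff F \<alpha>)"
  by (simp add: nmult_def xcoeff_sum)

text \<open>The formal partial derivative by \<open>x_i\<close>; the factor is the exponent of
  \<open>x_i\<close> in the monomial before differentiation.\<close>

definition xderiv :: "nat \<Rightarrow> 'r::{comm_ring, comm_monoid_mult} xseries \<Rightarrow> 'r xseries" where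
  "xderiv i F = Xseries (\<lambda>\<alpha>.
     nmult (Poly_Mapping.lookup \<alpha> i + 1) (xcoeff F (\<alpha> + Poly_Mapping.single i 1)))"

lemma xderiv_sum: "xderiv i (sum u A) = (\<Sum>k\<in>A. xderiv i (u k))"
  by (rule xseries_eqI) (simp add: xderiv_def xcoeff_sum nmult_sum)

text \<open>Indexing by the splittings of the monomial before differentiation, with the exponent as
  weight, gives both terms of the product rule the same index set, so that their weights can be
  added.\<close>

lemma xcoeff_xderiv_mult:
  "xcoeff (xderiv i F * G) \<alpha> =
     (\<Sum>(\<beta>, \<gamma>)\<in>splits (\<alpha> + Poly_Mapping.single i 1). nmult (Poly_Mapping.lookup \<beta> i) (xcoeff F \<beta> * xcoeff G \<gamma>))"
proof -
  let ?e = "Poly_Mapping.single i 1 :: nat \<Rightarrow>\<^sub>0 nat"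
  let ?s = "\<lambda>(\<beta>, \<gamma>). (\<beta> + ?e, \<gamma>)"
  have "(\<Sum>(\<beta>, \<gamma>)\<in>splits (\<alpha> + ?e). nmult (Poly_Mapping.lookup \<beta> i) (xcoeff F \<beta> * xcoeff G \<gamma>)) =
      (\<Sum>(\<beta>, \<gamma>)\<in>?s ` splits \<alpha>. nmult (Poly_Mapping.lookup \<beta> i) (xcoeff F \<beta> * xcoeff G \<gamma>))"
  proof (rule sum.mono_neutral_right)
    show "?s ` splits \<alpha> \<subseteq> splits (\<alpha> + ?e)"
      by (auto simp: splits_def ac_simps)
    \<comment> \<open>A splitting outside the image has no \<open>x_i\<close> in \<beta>, since
      otherwise one factor could be removed from it; its weight is 0.\<close>
    have "Poly_Mapping.lookup \<beta> i = 0" if "(\<beta>, \<gamma>) \<in> splits (\<alpha> + ?e) - ?s ` splits \<alpha>" for \<beta> \<gamma>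
    proof (rule ccontr)
      assume nz: "Poly_Mapping.lookup \<beta> i \<noteq> 0"
      have \<beta>: "\<beta> = (\<beta> - ?e) + ?e"
        by (rule poly_mapping_eqI) (use nz in \<open>auto simp: lookup_add lookup_minus lookup_single when_def\<close>)
      have "\<beta> + \<gamma> = \<alpha> + ?e" using that by (simp add: splits_def)
      then have "((\<beta> - ?e) + \<gamma>) + ?e = \<alpha> + ?e" by (metis \<beta> add.assoc add.commute)
      then have "(\<beta> - ?e, \<gamma>) \<in> splits \<alpha>" by (simp add: splits_def)
      then have "(\<beta>, \<gamma>) \<in> ?s ` splits \<alpha>" by (rule rev_image_eqI) (use \<beta> in simp)
      with that show False by blast
    qed
    then show "\<forall>p\<in>splits (\<alpha> + ?e) - ?s ` splits \<alpha>.
        (case p of (\<beta>, \<gamma>) \<Rightarrow> nmult (Poly_Mapping.lookup \<beta> i) (xcoeff F \<beta> * xcoeff G \<gamma>)) = 0"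
      by (auto simp del: nmult_0) (metis nmult_0(1))
  qed simp
  also have "\<dots> = (\<Sum>(\<beta>, \<gamma>)\<in>splits \<alpha>. nmult (Poly_Mapping.lookup \<beta> i + 1) (xcoeff F (\<beta> + ?e)) * xcoeff G \<gamma>)"
    by (subst sum.reindex)
      (auto intro!: inj_onI sum.cong simp: lookup_add lookup_single nmult_mult_left)
  finally show ?thesis by (simp add: times_xseries.rep_eq xderiv_def)
qed

lemma xderiv_mult: "xderiv i (F * G) = xderiv i F * G + F * xderiv i G"
proof (rule xseries_eqI)
  fix \<alpha> :: "nat \<Rightarrow>\<^sub>0 nat"
  let ?\<alpha>' = "\<alpha> + Poly_Mapping.single i 1"
  have "xcoeff (F * xderiv i G) \<alpha> =
      (\<Sum>(\<beta>, \<gamma>)\<in>splits ?\<alpha>'. nmult (Poly_Mapping.lookup \<beta> i) (xcoeff G \<beta> * xcoeff F \<gamma>))"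
    by (subst mult.commute) (rule xcoeff_xderiv_mult)
  also have "\<dots> = (\<Sum>(\<beta>, \<gamma>)\<in>splits ?\<alpha>'. nmult (Poly_Mapping.lookup \<gamma> i) (xcoeff F \<beta> * xcoeff G \<gamma>))"
    by (rule sum.reindex_bij_witness[of _ prod.swap prod.swap])
      (auto simp: splits_def add.commute mult.commute)
  finally have "xcoeff (xderiv i F * G + F * xderiv i G) \<alpha> =
      (\<Sum>(\<beta>, \<gamma>)\<in>splits ?\<alpha>'. nmult (Poly_Mapping.lookup (\<beta> + \<gamma>) i) (xcoeff F \<beta> * xcoeff G \<gamma>))"
    by (simp add: plus_xseries.rep_eq xcoeff_xderiv_mult sum.distrib[symmetric] case_prod_unfold
        lookup_add nmult_add_left)
  also have "\<dots> = xcoeff (xderiv i (F * G)) \<alpha>"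
  proof -
    \<comment> \<open>On the splittings the two weights add up to the exponent of \<open>x_i\<close>
      in \<open>?\<alpha>'\<close>, the factor that the derivative of the product puts in
      front.\<close>
    have l: "Poly_Mapping.lookup \<alpha> i + 1 = Poly_Mapping.lookup ?\<alpha>' i"
      by (simp add: lookup_add)
    show ?thesis
      unfolding xderiv_def xcoeff_Xseries times_xseries.rep_eq nmult_sum l
      by (rule sum.cong) (auto simp: splits_def)
  qed
  finally show "xcoeff (xderiv i (F * G)) \<alpha> = xcoeff (xderiv i F * G + F * xderiv i G) \<alpha>" ..
qed

text \<open>A colour acts as a derivation, d/dz or d/dx_i. Treating both alike gives a single
  product rule for the induction over coloured sets.\<close>

definition cderiv :: "nat option \<Rightarrow> 'r::{comm_ring, comm_monoid_mult} xseries fps \<Rightarrow> 'r xseries fps" where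
  "cderiv c F = Abs_fps (\<lambda>n. case c of None \<Rightarrow> nmult (n + 1) (fps_nth F (n + 1)) | Some i \<Rightarrow> xderiv i (fps_nth F n))"

lemma cderiv_mult: "cderiv c (F * G) = cderiv c F * G + F * cderiv c G"
proof (cases c)
  case (Some i)
  show ?thesis
    by (rule fps_ext) (simp add: Some cderiv_def fps_mult_nth xderiv_sum xderiv_mult sum.distrib)
next
  case None
  have "fps_nth (cderiv None (F * G)) n = fps_nth (cderiv None F * G + F * cderiv None G) n" for n
  proof -
    let ?F = "fps_nth F" and ?G = "fps_nth G"
    \<comment> \<open>The factor \<open>n + 1\<close> is distributed as
      \<open>i + (n + 1 - i)\<close>. The first term of the one sum and the last term of the other
      then have weight 0, hence the shift of the first sum and the shortening of the second.\<close>
    have "nmult (n + 1) (\<Sum>i=0..n + 1. ?F i * ?G (n + 1 - i)) =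
        (\<Sum>i=0..n + 1. nmult i (?F i * ?G (n + 1 - i)) + nmult (n + 1 - i) (?F i * ?G (n + 1 - i)))"
      unfolding nmult_sum by (intro sum.cong refl) (simp add: nmult_add_left[symmetric])
    also have "\<dots> = (\<Sum>i=0..n + 1. nmult i (?F i) * ?G (n + 1 - i)) +
        (\<Sum>i=0..n + 1. ?F i * nmult (n + 1 - i) (?G (n + 1 - i)))"
      by (simp only: sum.distrib nmult_mult_left nmult_mult_right)
    also have "(\<Sum>i=0..n + 1. nmult i (?F i) * ?G (n + 1 - i)) =
        (\<Sum>i=0..n. nmult (i + 1) (?F (i + 1)) * ?G (n - i))"
      by (simp add: sum.atLeast0_atMost_Suc_shift del: sum.cl_ivl_Suc)
    also have "(\<Sum>i=0..n + 1. ?F i * nmult (n + 1 - i) (?G (n + 1 - i))) =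
        (\<Sum>i=0..n. ?F i * nmult (n - i + 1) (?G (n - i + 1)))"
      by (simp add: Suc_diff_le)
    finally show ?thesis by (simp only: cderiv_def fps_mult_nth fps_add_nth fps_nth_Abs_fps option.case)
  qed
  then show ?thesis unfolding None by (rule fps_ext)
qed

text \<open>Together with \<open>ztype\<close> this is the exponent vector of the product of the
  variables that colour the elements of \<open>V\<close>.\<close>

definition xtype :: "('v \<Rightarrow> nat option) \<Rightarrow> 'v set \<Rightarrow> (nat \<Rightarrow>\<^sub>0 nat)" where
  "xtype col V = (\<Sum>v\<in>V. case col v of None \<Rightarrow> 0 | Some i \<Rightarrow> Poly_Mapping.single i 1)"

definition ztype :: "('v \<Rightarrow> nat option) \<Rightarrow> 'v set \<Rightarrow> nat" where
  "ztype col V = card {v\<in>V. col v = None}"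

definition xfact :: "(nat \<Rightarrow>\<^sub>0 nat) \<Rightarrow> nat" where
  "xfact \<alpha> = (\<Prod>i\<in>Poly_Mapping.keys \<alpha>. fact (Poly_Mapping.lookup \<alpha> i))"

lemma xfact_eq:
  "finite A \<Longrightarrow> Poly_Mapping.keys \<alpha> \<subseteq> A \<Longrightarrow> xfact \<alpha> = (\<Prod>i\<in>A. fact (Poly_Mapping.lookup \<alpha> i))"
  unfolding xfact_def by (rule prod.mono_neutral_left) (auto simp: in_keys_iff)

lemma xfact_pos: "xfact \<alpha> > 0"
  by (auto simp: xfact_def)

lemma xfact_add_single:
  "xfact (\<alpha> + Poly_Mapping.single i 1) = xfact \<alpha> * (Poly_Mapping.lookup \<alpha> i + 1)"
proof -
  let ?A = "insert i (Poly_Mapping.keys \<alpha>)"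
  have "Poly_Mapping.keys (\<alpha> + Poly_Mapping.single i 1) \<subseteq> ?A"
    by (auto simp: in_keys_iff lookup_add lookup_single when_def split: if_splits)
  then have "xfact (\<alpha> + Poly_Mapping.single i 1) =
      (\<Prod>k\<in>?A. fact (Poly_Mapping.lookup (\<alpha> + Poly_Mapping.single i 1) k))"
    by (intro xfact_eq) auto
  also have "\<dots> = fact (Poly_Mapping.lookup \<alpha> i + 1) * (\<Prod>k\<in>?A - {i}. fact (Poly_Mapping.lookup \<alpha> k))"
    by (subst prod.remove[of _ i])
      (auto simp: lookup_add lookup_single when_def intro!: prod.cong)
  also have "\<dots> = (Poly_Mapping.lookup \<alpha> i + 1) * (\<Prod>k\<in>?A. fact (Poly_Mapping.lookup \<alpha> k))"
    by (subst (2) prod.remove[of _ i]) (auto simp: algebra_simps)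
  also have "(\<Prod>k\<in>?A. fact (Poly_Mapping.lookup \<alpha> k)) = xfact \<alpha>"
    by (intro xfact_eq[symmetric]) auto
  finally show ?thesis by (simp add: algebra_simps)
qed

text \<open>
  The coefficient of \<open>F\<close> at the monomial of the coloured set \<open>V\<close>, multiplied by the factorials of
  all exponents; equivalently, the constant term of \<open>F\<close> differentiated once for every element of
  \<open>V\<close>. The colour \<open>Some i\<close> stands for the variable \<open>x\<^sub>i\<close>, the colour \<open>None\<close> for \<open>z\<close>.
\<close>

definition lab ::
  "('v \<Rightarrow> nat option) \<Rightarrow> 'r::{comm_ring, comm_monoid_mult} xseries fps \<Rightarrow> 'v set \<Rightarrow> 'r" where
  "lab col F V = nmult (xfact (xtype col V) * fact (ztype col V))
     (xcoeff (fps_nth F (ztype col V)) (xtype col V))"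

lemma lab_add: "lab col (F + G) V = lab col F V + lab col G V"
  by (simp add: lab_def plus_xseries.rep_eq nmult_add)

text \<open>Raising one exponent multiplies the product of factorials by the new exponent, which is
  exactly the factor that the derivative brings down.\<close>

lemma lab_insert:
  assumes "finite V" "v \<notin> V"
  shows "lab col F (insert v V) = lab col (cderiv (col v) F) V"
proof (cases "col v")
  case None
  then have "{u \<in> insert v V. col u = None} = insert v {u\<in>V. col u = None}" by auto
  then have "ztype col (insert v V) = Suc (ztype col V)"
    using assms by (simp add: ztype_def)
  moreover have "xtype col (insert v V) = xtype col V"
    using assms None by (simp add: xtype_def)
  moreover have "xfact \<alpha> * fact (Suc n) = xfact \<alpha> * fact n * (n + 1)" for \<alpha> n
    by (simp add: algebra_simps)
  ultimately show ?thesis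
    by (simp only: lab_def cderiv_def None option.case fps_nth_Abs_fps xcoeff_nmult nmult_nmult Suc_eq_plus1)
next
  case (Some i)
  then have "{u \<in> insert v V. col u = None} = {u\<in>V. col u = None}" by auto
  then have "ztype col (insert v V) = ztype col V"
    using assms by (simp add: ztype_def)
  moreover have "xtype col (insert v V) = xtype col V + Poly_Mapping.single i 1"
    using assms Some by (simp add: xtype_def add.commute)
  moreover have "xfact \<alpha> * (k + 1) * fact n = xfact \<alpha> * fact n * (k + 1)" for \<alpha> k n
    by (simp add: algebra_simps)
  ultimately show ?thesis
    by (simp only: lab_def cderiv_def Some option.case fps_nth_Abs_fps xderiv_def xcoeff_Xseries nmult_nmult
         xfact_add_single)
qed

lemma lab_empty: "lab col F {} = xcoeff (fps_nth F 0) 0"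
  by (simp add: lab_def ztype_def xtype_def xfact_def)

lemma splits_0: "splits 0 = {(0, 0)}"
proof (rule set_eqI, clarify)
  fix \<beta> \<gamma> :: "nat \<Rightarrow>\<^sub>0 nat"
  have "\<beta> + \<gamma> = 0 \<longleftrightarrow> \<beta> = 0 \<and> \<gamma> = 0"
    unfolding mdegree_eq_0[symmetric] mdegree_add by (rule add_eq_0_iff_both_eq_0)
  then show "(\<beta>, \<gamma>) \<in> splits 0 \<longleftrightarrow> (\<beta>, \<gamma>) \<in> {(0, 0)}"
    by (simp add: splits_def)
qed

text \<open>By induction on \<open>V\<close>: the derivative for the inserted element falls either
  on \<open>F\<close>, which puts the element into \<open>S\<close>, or on \<open>G\<close>, which
  leaves it in the complement.\<close>

lemma lab_mult:
  assumes "finite V"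
  shows "lab col (F * G) V = (\<Sum>S\<in>Pow V. lab col F S * lab col G (V - S))"
  using assms
proof (induction V arbitrary: F G rule: finite_induct)
  case empty
  show ?case by (simp add: lab_empty times_xseries.rep_eq splits_0)
next
  case (insert v V)
  have fin: "finite S" "v \<notin> S" if "S \<in> Pow V" for S
    using that insert.hyps by (auto intro: finite_subset)
  have "lab col (F * G) (insert v V) =
      (\<Sum>S\<in>Pow V. lab col F S * lab col (cderiv (col v) G) (V - S)) +
      (\<Sum>S\<in>Pow V. lab col (cderiv (col v) F) S * lab col G (V - S))"
    using insert by (simp add: lab_insert cderiv_mult lab_add add.commute)
  also have "(\<Sum>S\<in>Pow V. lab col F S * lab col (cderiv (col v) G) (V - S)) =
      (\<Sum>S\<in>Pow V. lab col F S * lab col G (insert v V - S))"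
  proof (rule sum.cong)
    fix S assume S: "S \<in> Pow V"
    then have "insert v V - S = insert v (V - S)" using insert by auto
    then show "lab col F S * lab col (cderiv (col v) G) (V - S) = lab col F S * lab col G (insert v V - S)"
      using insert by (simp add: lab_insert)
  qed simp
  also have "(\<Sum>S\<in>Pow V. lab col (cderiv (col v) F) S * lab col G (V - S)) =
      (\<Sum>S\<in>insert v ` Pow V. lab col F S * lab col G (insert v V - S))"
  proof (subst sum.reindex)
    show "inj_on (insert v) (Pow V)"
      by (rule inj_onI) (metis fin(2) insert_ident)
    show "(\<Sum>S\<in>Pow V. lab col (cderiv (col v) F) S * lab col G (V - S)) =
      (\<Sum>S\<in>Pow V. ((\<lambda>S. lab col F S * lab col G (insert v V - S)) \<circ> insert v) S)"
    proof (rule sum.cong)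
      fix S assume S: "S \<in> Pow V"
      then have "insert v V - insert v S = V - S" using insert by auto
      then show "lab col (cderiv (col v) F) S * lab col G (V - S) =
          ((\<lambda>S. lab col F S * lab col G (insert v V - S)) \<circ> insert v) S"
        using fin[OF S] by (simp add: lab_insert)
    qed simp
  qed
  also have "(\<Sum>S\<in>Pow V. lab col F S * lab col G (insert v V - S)) +
      (\<Sum>S\<in>insert v ` Pow V. lab col F S * lab col G (insert v V - S)) =
      (\<Sum>S\<in>Pow (insert v V). lab col F S * lab col G (insert v V - S))"
    unfolding Pow_insert using insert
    by (intro sum.union_disjoint[symmetric]) auto
  finally show ?case .
qed

text \<open>The iterated product rule yields sequences of \<open>j\<close> disjoint sets covering
  \<open>V\<close>. The vanishing constant term of \<open>G\<close> discards those with an empty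
  member; the others are the \<open>fact j\<close> orderings of the partitions into \<open>j\<close>
  blocks.\<close>

lemma lab_pow:
  fixes col :: "'v \<Rightarrow> nat option" and G :: "'r::{comm_ring, comm_monoid_mult} xseries fps"
  assumes "finite V" and G: "xcoeff (fps_nth G 0) 0 = 0"
  shows "lab col (fps_pow G j) V =
    nmult (fact j) (\<Sum>P | partition_on V P \<and> card P = j. \<Prod>W\<in>P. lab col G W)"
  using assms(1)
proof (induction j arbitrary: V)
  case 0
  have eq: "{P. partition_on V P \<and> card P = 0} = (if V = {} then {{}} else {})"
    using finite_elements[OF \<open>finite V\<close>] by (auto simp: partition_on_empty partition_on_def)
  show ?case
  proof (cases "V = {}")
    case True
    then show ?thesis unfolding eq by (simp add: lab_empty one_xseries.rep_eq)
  next
    case False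
    have "xtype col V \<noteq> 0 \<or> ztype col V \<noteq> 0"
    proof -
      from False obtain v where v: "v \<in> V" by blast
      show ?thesis
      proof (cases "col v")
        case None
        then have "ztype col V \<noteq> 0" using v \<open>finite V\<close> by (auto simp: ztype_def)
        then show ?thesis ..
      next
        case (Some i)
        have "xtype col V = Poly_Mapping.single i 1 +
            (\<Sum>v\<in>V - {v}. case col v of None \<Rightarrow> 0 | Some i \<Rightarrow> Poly_Mapping.single i 1)"
          unfolding xtype_def using v \<open>finite V\<close> Some by (subst sum.remove[of _ v]) auto
        then have "Poly_Mapping.lookup (xtype col V) i \<noteq> 0" by (simp add: lookup_add)
        then have "xtype col V \<noteq> 0" by auto
        then show ?thesis ..
      qed
    qed
    then have "lab col 1 V = (0 :: 'r)"
      by (auto simp: lab_def one_xseries.rep_eq zero_xseries.rep_eq)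
    then show ?thesis using False unfolding eq by simp
  qed
next
  case (Suc j)
  let ?w = "\<lambda>P. \<Prod>W\<in>P. lab col G W"
  let ?part = "\<lambda>V j. {P. partition_on V P \<and> card P = j}"
  have fin: "finite (?part U i)" if "finite U" for U :: "'v set" and i
    using finitely_many_partition_on[OF that] by (rule rev_finite_subset) auto
  have finP: "finite P" if "partition_on V P" for P
    using that finite_elements[OF \<open>finite V\<close>] by blast
  have "lab col (fps_pow G (Suc j)) V =
      (\<Sum>W\<in>Pow V. lab col G W * nmult (fact j) (\<Sum>P\<in>?part (V - W) j. ?w P))"
    using Suc by (simp add: lab_mult)
  also have "\<dots> = (\<Sum>W\<in>Pow V - {{}}. lab col G W * nmult (fact j) (\<Sum>P\<in>?part (V - W) j. ?w P))"
    using Suc.prems by (intro sum.mono_neutral_right) (auto simp: lab_empty G)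
  also have "\<dots> = nmult (fact j) (\<Sum>(W, P)\<in>Sigma (Pow V - {{}}) (\<lambda>W. ?part (V - W) j). lab col G W * ?w P)"
  proof (subst sum.Sigma[symmetric])
    show "finite (Pow V - {{}})" using Suc.prems by simp
    show "\<forall>W\<in>Pow V - {{}}. finite (?part (V - W) j)"
      by (intro ballI fin finite_Diff Suc.prems)
    show "(\<Sum>W\<in>Pow V - {{}}. lab col G W * nmult (fact j) (\<Sum>P\<in>?part (V - W) j. ?w P)) =
        nmult (fact j) (\<Sum>W\<in>Pow V - {{}}. \<Sum>P\<in>?part (V - W) j. lab col G W * ?w P)"
      by (simp only: nmult_mult_right sum_distrib_left nmult_sum)
  qed
  \<comment> \<open>Splitting off the first factor \<open>W\<close> amounts to marking a block of a
    partition into \<open>Suc j\<close> blocks. Each such partition is met \<open>Suc j\<close>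
    times, which turns \<open>fact j\<close> into \<open>fact (Suc j)\<close>.\<close>
  also have "(\<Sum>(W, P)\<in>Sigma (Pow V - {{}}) (\<lambda>W. ?part (V - W) j). lab col G W * ?w P) =
      (\<Sum>(P, W)\<in>Sigma (?part V (Suc j)) (\<lambda>P. P). ?w P)"
  proof (rule sum.reindex_bij_witness[of _ "\<lambda>(P, W). (W, P - {W})" "\<lambda>(W, P). (insert W P, W)"])
    fix p assume "p \<in> Sigma (Pow V - {{}}) (\<lambda>W. ?part (V - W) j)"
    then obtain W P where p: "p = (W, P)" and W: "W \<subseteq> V" "W \<noteq> {}"
      and P: "partition_on (V - W) P" "card P = j" by auto
    have nW: "W \<notin> P" using P(1) W(2) by (auto simp: partition_on_def)
    have fP: "finite P" using finite_elements[OF _ P(1)] \<open>finite V\<close> by simp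
    have "disjnt W (\<Union>P)" using P(1) by (auto simp: partition_on_def disjnt_def)
    then have "partition_on V (insert W P)" using P(1) W by (simp add: partition_on_insert)
    then show "(case p of (W, P) \<Rightarrow> (insert W P, W)) \<in> Sigma (?part V (Suc j)) (\<lambda>P. P)"
      using p P nW fP by simp
    show "(case case p of (W, P) \<Rightarrow> (insert W P, W) of (P, W) \<Rightarrow> (W, P - {W})) = p"
      using p nW by simp
    show "(case case p of (W, P) \<Rightarrow> (insert W P, W) of (P, W) \<Rightarrow> ?w P) =
        (case p of (W, P) \<Rightarrow> lab col G W * ?w P)"
      using p nW fP by simp
  next
    fix p assume "p \<in> Sigma (?part V (Suc j)) (\<lambda>P. P)"
    then obtain P W where p: "p = (P, W)" and W: "W \<in> P"
      and P: "partition_on V P" "card P = Suc j" by auto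
    have fP: "finite P" using finite_elements[OF _ P(1)] \<open>finite V\<close> by simp
    have "partition_on (V - W) (P - {W})"
      using P(1) W by (auto simp: partition_on_def disjoint_def)
    moreover have "card (P - {W}) = j" using P(2) W fP by simp
    moreover have "W \<subseteq> V" "W \<noteq> {}" using P(1) W by (auto simp: partition_on_def)
    ultimately show "(case p of (P, W) \<Rightarrow> (W, P - {W})) \<in> Sigma (Pow V - {{}}) (\<lambda>W. ?part (V - W) j)"
      using p by simp
    show "(case case p of (P, W) \<Rightarrow> (W, P - {W}) of (W, P) \<Rightarrow> (insert W P, W)) = p"
      using p W by auto
  qed
  also have "\<dots> = (\<Sum>P\<in>?part V (Suc j). nmult (Suc j) (?w P))"
  proof (subst sum.Sigma[symmetric])
    show "finite (?part V (Suc j))" by (rule fin[OF Suc.prems])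
    show "\<forall>P\<in>?part V (Suc j). finite P" using finP by simp
    show "(\<Sum>P\<in>?part V (Suc j). \<Sum>W\<in>P. ?w P) = (\<Sum>P\<in>?part V (Suc j). nmult (Suc j) (?w P))"
    proof (rule sum.cong)
      fix P assume "P \<in> ?part V (Suc j)"
      then have "card P = Suc j" by simp
      then obtain h where "bij_betw h {..<Suc j} P"
        using ex_bij_betw_nat_finite[of P] by (metis atLeast0LessThan card_ge_0_finite zero_less_Suc)
      then show "(\<Sum>W\<in>P. ?w P) = nmult (Suc j) (?w P)"
        unfolding nmult_def by (rule sum.reindex_bij_betw[symmetric])
    qed simp
  qed
  also have "nmult (fact j) \<dots> = nmult (fact (Suc j)) (\<Sum>P\<in>?part V (Suc j). ?w P)"
    by (simp add: nmult_sum nmult_nmult mult.commute)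
  finally show ?case .
qed

lemma lab_const:
  assumes "finite V"
  shows "lab col (fps_const c) V =
    (if \<forall>v\<in>V. col v \<noteq> None then nmult (xfact (xtype col V)) (xcoeff c (xtype col V)) else 0)"
proof -
  have "ztype col V = 0 \<longleftrightarrow> (\<forall>v\<in>V. col v \<noteq> None)"
    using assms by (auto simp: ztype_def)
  then show ?thesis by (auto simp: lab_def zero_xseries.rep_eq)
qed

lemma mdegree_single: "mdegree (Poly_Mapping.single i k) = k"
  by (simp add: mdegree_def)

lemma lab_const_nmult: "lab col (fps_const (nmult k c)) V = nmult k (lab col (fps_const c) V)"
  by (simp add: lab_def xcoeff_nmult nmult_nmult mult.commute zero_xseries.rep_eq)

lemma card_partition_on_le:
  assumes "finite A" "partition_on A P"
  shows "card P \<le> card A"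
proof (rule card_inj_on_le)
  have ex: "(SOME x. x \<in> W) \<in> W" if "W \<in> P" for W
    using that assms(2) by (auto simp: partition_on_def intro: some_in_eq[THEN iffD2])
  show "inj_on (\<lambda>W. SOME x. x \<in> W) P"
    using ex assms(2) by (intro inj_onI) (metis partition_on_def disjointD disjoint_iff)
  show "(\<lambda>W. SOME x. x \<in> W) ` P \<subseteq> A"
    using ex assms(2) by (auto simp: partition_on_def)
qed (rule assms)

lemma mdegree_xtype:
  assumes "finite V"
  shows "ztype col V + mdegree (xtype col V) = card V"
proof -
  have "mdegree (xtype col V) = (\<Sum>v\<in>V. if col v = None then 0 else 1)"
    unfolding xtype_def using assms
    by (induction V rule: finite_induct)
      (auto simp: mdegree_add mdegree_single mdegree_eq_0 split: option.split)
  also have "\<dots> = card {v\<in>V. col v \<noteq> None}"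
    using assms by (simp add: sum.If_cases Int_def)
  finally have "ztype col V + mdegree (xtype col V) = card ({v\<in>V. col v = None} \<union> {v\<in>V. col v \<noteq> None})"
    unfolding ztype_def using assms by (subst card_Un_disjoint) auto
  also have "{v\<in>V. col v = None} \<union> {v\<in>V. col v \<noteq> None} = V" by auto
  finally show ?thesis .
qed

text \<open>A version of Faa di Bruno's formula: \<open>lab_mult\<close> shares \<open>V\<close> out
  between the \<open>j\<close>-th coefficient of \<open>F\<close> and the \<open>j\<close>-th power
  of \<open>G\<close>, \<open>lab_pow\<close> partitions the second share, and its factor
  \<open>fact j\<close> moves to the coefficient of \<open>F\<close>. Summing over \<open>j\<close>
  lifts the restriction on the number of blocks.\<close>

lemma lab_zsubst:
  assumes V: "finite V" and G: "xcoeff (fps_nth G 0) 0 = 0"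
  shows "lab col (zsubst F G) V = (\<Sum>S\<in>Pow V. \<Sum>P | partition_on (V - S) P.
    lab col (fps_const (nmult (fact (card P)) (fps_nth F (card P)))) S * (\<Prod>W\<in>P. lab col G W))"
proof -
  let ?n = "ztype col V" and ?\<alpha> = "xtype col V"
  let ?t = "\<lambda>j. fps_const (fps_nth F j) * fps_pow G j"
  let ?w = "\<lambda>P. \<Prod>W\<in>P. lab col G W"
  \<comment> \<open>The monomial of \<open>V\<close> has total degree \<open>card V\<close>, and
    each factor \<open>G\<close> uses up degree at least 1, so larger \<open>j\<close> contribute
    nothing.\<close>
  have zero: "xcoeff (fps_nth (?t j) ?n) ?\<alpha> = 0" if "card V < j" for j
  proof -
    have "xcoeff (fps_nth (fps_pow G j) ?n) \<gamma> = 0" if "\<beta> + \<gamma> = ?\<alpha>" for \<beta> \<gamma>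
      using mdegree_xtype[OF V, of col] that \<open>card V < j\<close> mdegree_add[of \<beta> \<gamma>]
      by (intro fps_pow_vanishes G) auto
    then show ?thesis
      by (auto simp: times_xseries.rep_eq splits_def intro!: sum.neutral)
  qed
  have "xcoeff (fps_nth (zsubst F G) ?n) ?\<alpha> = (\<Sum>j | xcoeff (fps_nth (?t j) ?n) ?\<alpha> \<noteq> 0. xcoeff (fps_nth (?t j) ?n) ?\<alpha>)"
    by (simp add: zsubst_def xsum_def)
  also have "\<dots> = (\<Sum>j\<le>card V. xcoeff (fps_nth (?t j) ?n) ?\<alpha>)"
    using zero by (intro sum.mono_neutral_left) (auto simp: not_less[symmetric] simp del: fps_mult_left_const_nth)
  finally have "lab col (zsubst F G) V = (\<Sum>j\<le>card V. lab col (?t j) V)"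
    by (simp only: lab_def nmult_sum)
  also have "\<dots> = (\<Sum>j\<le>card V. \<Sum>S\<in>Pow V. \<Sum>P | partition_on (V - S) P \<and> card P = j.
      lab col (fps_const (nmult (fact (card P)) (fps_nth F (card P)))) S * ?w P)"
    using V
    by (intro sum.cong refl)
      (auto simp: lab_mult lab_pow[OF _ G] lab_const_nmult sum_distrib_left nmult_sum nmult_mult_left nmult_mult_right
         intro!: sum.cong)
  also have "\<dots> = (\<Sum>S\<in>Pow V. \<Sum>j\<le>card V. \<Sum>P | partition_on (V - S) P \<and> card P = j.
      lab col (fps_const (nmult (fact (card P)) (fps_nth F (card P)))) S * ?w P)"
    by (rule sum.swap)
  also have "\<dots> = (\<Sum>S\<in>Pow V. \<Sum>P | partition_on (V - S) P.
      lab col (fps_const (nmult (fact (card P)) (fps_nth F (card P)))) S * ?w P)"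
  proof (rule sum.cong)
    fix S assume "S \<in> Pow V"
    let ?A = "{P. partition_on (V - S) P}"
    have fin: "finite ?A" using V by (intro finitely_many_partition_on) simp
    have "card ` ?A \<subseteq> {..card V}"
    proof safe
      fix P assume P: "partition_on (V - S) P"
      have "card P \<le> card (V - S)"
        using V P by (intro card_partition_on_le) auto
      then show "card P \<le> card V" using V card_mono[of V "V - S"] by simp
    qed
    from sum.group[OF fin _ this, of "\<lambda>P. lab col (fps_const (nmult (fact (card P)) (fps_nth F (card P)))) S * ?w P"]
    show "(\<Sum>j\<le>card V. \<Sum>P | partition_on (V - S) P \<and> card P = j.
        lab col (fps_const (nmult (fact (card P)) (fps_nth F (card P)))) S * ?w P) =
      (\<Sum>P | partition_on (V - S) P. lab col (fps_const (nmult (fact (card P)) (fps_nth F (card P)))) S * ?w P)"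
      by simp
  qed simp
  finally show ?thesis .
qed

section \<open>Graph isomorphisms and the product of graphic functions\<close>

lemma graph_iso_sym:
  assumes "graph_iso \<Gamma> \<Delta>" "pair_graph \<Gamma>"
  shows "graph_iso \<Delta> \<Gamma>"
proof -
  interpret pair_graph \<Gamma> by fact
  show ?thesis using assms(1) unfolding graph_iso_def by (rule digraph_iso_swap[OF wf_digraph_axioms])
qed

lemma graph_iso_trans: "graph_iso \<Gamma> \<Delta> \<Longrightarrow> graph_iso \<Delta> \<Theta> \<Longrightarrow> graph_iso \<Gamma> \<Theta>"
  unfolding graph_iso_def by (rule digraph_iso_trans)

lemma connected_graph_iso:
  "graph_iso \<Gamma> \<Delta> \<Longrightarrow> Digraph_Component.connected (with_proj \<Gamma>) \<Longrightarrow>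
    Digraph_Component.connected (with_proj \<Delta>)"
  unfolding graph_iso_def digraph_iso_def
  by (metis wf_digraph.connectedI_app_iso pre_digraph.digraph_isomorphism_def)

lemma pair_graphI:
  assumes "finite (pverts \<Gamma>)" "parcs \<Gamma> \<subseteq> pverts \<Gamma> \<times> pverts \<Gamma>"
    and "\<And>u v. (u, v) \<in> parcs \<Gamma> \<Longrightarrow> u \<noteq> v" "\<And>u v. (u, v) \<in> parcs \<Gamma> \<Longrightarrow> (v, u) \<in> parcs \<Gamma>"
  shows "pair_graph \<Gamma>"
proof
  show "finite (parcs \<Gamma>)" using assms(1,2) by (auto intro: finite_subset)
  show "symmetric \<Gamma>" using assms(4) by (auto simp: symmetric_def intro: symI)
qed (use assms in auto)

lemma pair_graph_parcs:
  assumes "pair_graph \<Gamma>"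
  shows "finite (pverts \<Gamma>)" "parcs \<Gamma> \<subseteq> pverts \<Gamma> \<times> pverts \<Gamma>"
    and "(u, v) \<in> parcs \<Gamma> \<Longrightarrow> u \<noteq> v" "(u, v) \<in> parcs \<Gamma> \<Longrightarrow> (v, u) \<in> parcs \<Gamma>"
proof -
  interpret pair_graph \<Gamma> by fact
  show "finite (pverts \<Gamma>)" by (rule pair_finite_verts)
  show "parcs \<Gamma> \<subseteq> pverts \<Gamma> \<times> pverts \<Gamma>" by (auto dest: in_arcsD1 in_arcsD2)
  show "(u, v) \<in> parcs \<Gamma> \<Longrightarrow> u \<noteq> v" using no_loops' by blast
  show "(u, v) \<in> parcs \<Gamma> \<Longrightarrow> (v, u) \<in> parcs \<Gamma>" using arcs_symmetric by blast
qed

text \<open>Naming the vertex map allows images of tubes and of whole partitions to be formed.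
  Simplicity of the source passes to the target, which makes the relation symmetric.\<close>

definition iso_by :: "('a \<Rightarrow> 'b) \<Rightarrow> 'a pair_pre_digraph \<Rightarrow> 'b pair_pre_digraph \<Rightarrow> bool" where
  "iso_by \<phi> \<Gamma> \<Delta> \<longleftrightarrow> pair_graph \<Gamma> \<and> bij_betw \<phi> (pverts \<Gamma>) (pverts \<Delta>) \<and> parcs \<Delta> = map_prod \<phi> \<phi> ` parcs \<Gamma>"

lemma iso_by_graph_iso: "iso_by \<phi> \<Gamma> \<Delta> \<Longrightarrow> graph_iso \<Gamma> \<Delta>"
  unfolding iso_by_def using graph_iso_bij[of \<Gamma> \<Delta>] by metis

lemma graph_iso_iso_by: "pair_graph \<Gamma> \<Longrightarrow> graph_iso \<Gamma> \<Delta> \<Longrightarrow> \<exists>\<phi>. iso_by \<phi> \<Gamma> \<Delta>"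
  unfolding iso_by_def using graph_iso_bij[of \<Gamma> \<Delta>] by metis

lemma iso_by_sym:
  assumes "iso_by \<phi> \<Gamma> \<Delta>"
  shows "iso_by (the_inv_into (pverts \<Gamma>) \<phi>) \<Delta> \<Gamma>"
proof -
  let ?\<psi> = "the_inv_into (pverts \<Gamma>) \<phi>"
  have \<Gamma>: "pair_graph \<Gamma>" and bij: "bij_betw \<phi> (pverts \<Gamma>) (pverts \<Delta>)"
    and A: "parcs \<Delta> = map_prod \<phi> \<phi> ` parcs \<Gamma>"
    using assms by (auto simp: iso_by_def)
  note G = pair_graph_parcs[OF \<Gamma>]
  have inj: "inj_on \<phi> (pverts \<Gamma>)" using bij by (simp add: bij_betw_def)
  have "pair_graph \<Delta>"
  proof (rule pair_graphI)
    show "finite (pverts \<Delta>)" using G(1) bij_betw_finite[OF bij] by blast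
    show "parcs \<Delta> \<subseteq> pverts \<Delta> \<times> pverts \<Delta>"
    proof
      fix p assume "p \<in> parcs \<Delta>"
      then obtain x y where "(x, y) \<in> parcs \<Gamma>" "p = (\<phi> x, \<phi> y)" unfolding A by auto
      then show "p \<in> pverts \<Delta> \<times> pverts \<Delta>" using G(2) bij_betwE[OF bij] by blast
    qed
    show "u \<noteq> v" if uv: "(u, v) \<in> parcs \<Delta>" for u v
    proof -
      obtain x y where xy: "(x, y) \<in> parcs \<Gamma>" "u = \<phi> x" "v = \<phi> y" using uv unfolding A by auto
      then have "x \<in> pverts \<Gamma>" "y \<in> pverts \<Gamma>" using G(2) by auto
      then show ?thesis using inj_onD[OF inj] G(3)[OF xy(1)] xy(2,3) by blast
    qed
    show "(v, u) \<in> parcs \<Delta>" if uv: "(u, v) \<in> parcs \<Delta>" for u v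
    proof -
      obtain x y where xy: "(x, y) \<in> parcs \<Gamma>" "u = \<phi> x" "v = \<phi> y" using uv unfolding A by auto
      show ?thesis unfolding A by (rule rev_image_eqI[OF G(4)[OF xy(1)]]) (simp add: xy)
    qed
  qed
  moreover have "bij_betw ?\<psi> (pverts \<Delta>) (pverts \<Gamma>)"
    using bij by (rule bij_betw_the_inv_into)
  moreover have "parcs \<Gamma> = map_prod ?\<psi> ?\<psi> ` parcs \<Delta>"
  proof -
    have "map_prod ?\<psi> ?\<psi> (map_prod \<phi> \<phi> a) = a" if "a \<in> parcs \<Gamma>" for a
    proof -
      obtain x y where a: "a = (x, y)" by (cases a)
      then have "x \<in> pverts \<Gamma>" "y \<in> pverts \<Gamma>" using G(2) that by auto
      then show ?thesis unfolding a by (simp add: the_inv_into_f_f[OF inj])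
    qed
    then have "(\<lambda>a. map_prod ?\<psi> ?\<psi> (map_prod \<phi> \<phi> a)) ` parcs \<Gamma> = (\<lambda>a. a) ` parcs \<Gamma>"
      by (rule image_cong[OF refl])
    then show ?thesis unfolding A image_image by (metis image_ident)
  qed
  ultimately show ?thesis by (simp add: iso_by_def)
qed

text \<open>Isomorphic graphs have the same copies over the naturals, so the choice operator in
  \<open>gval\<close> picks the same one for both.\<close>

lemma gval_iso:
  assumes "graph_iso \<Gamma> \<Delta>" "pair_graph \<Gamma>"
  shows "gval f \<Gamma> = gval f \<Delta>"
proof -
  have "graph_iso \<Gamma> \<Theta> \<longleftrightarrow> graph_iso \<Delta> \<Theta>" for \<Theta> :: "nat pair_pre_digraph"
    using graph_iso_trans[OF assms(1), of \<Theta>] graph_iso_trans[OF graph_iso_sym[OF assms], of \<Theta>] by argo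
  then show ?thesis by (simp add: gval_def)
qed

text \<open>All copies of a connected graph are connected, and \<open>graphic\<close> forces equal
  values on them; hence the arbitrary choice in \<open>gval\<close> does not show.\<close>

lemma gval_eq:
  fixes \<Delta> :: "nat pair_pre_digraph"
  assumes "graphic f" "connected_graph \<Gamma>" "graph_iso \<Gamma> \<Delta>"
  shows "gval f \<Gamma> = f \<Delta>"
proof -
  let ?\<Theta> = "SOME \<Theta> :: nat pair_pre_digraph. graph_iso \<Gamma> \<Theta>"
  have \<Gamma>: "pair_graph \<Gamma>" using assms(2) by (simp add: connected_graph_def)
  have \<Theta>: "graph_iso \<Gamma> ?\<Theta>" using assms(3) by (rule someI)
  have conn: "connected_graph \<Lambda>" if iso: "graph_iso \<Gamma> \<Lambda>" for \<Lambda> :: "nat pair_pre_digraph"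
  proof -
    obtain \<phi> where "iso_by \<phi> \<Gamma> \<Lambda>" using graph_iso_iso_by[OF \<Gamma> iso] by blast
    then have "pair_graph \<Lambda>" using iso_by_sym iso_by_def by metis
    then show ?thesis using connected_graph_iso[OF iso] assms(2) by (simp add: connected_graph_def)
  qed
  have iso: "graph_iso ?\<Theta> \<Delta>"
    using graph_iso_trans[OF graph_iso_sym[OF \<Theta> \<Gamma>] assms(3)] .
  have "f ?\<Theta> = f \<Delta>"
    by (rule assms(1)[unfolded graphic_def, rule_format]) (use conn[OF \<Theta>] conn[OF assms(3)] iso in simp)
  then show ?thesis unfolding gval_def .
qed

lemma pair_graph_induced:
  assumes "pair_graph \<Gamma>" "W \<subseteq> pverts \<Gamma>"
  shows "pair_graph (induced \<Gamma> W)"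
proof (rule pair_graphI)
  show "finite (pverts (induced \<Gamma> W))"
    using finite_subset[OF assms(2) pair_graph_parcs(1)[OF assms(1)]] by (simp add: induced_def)
  show "u \<noteq> v" if "(u, v) \<in> parcs (induced \<Gamma> W)" for u v
    using that pair_graph_parcs(3)[OF assms(1), of u v] by (simp add: induced_def)
  show "(v, u) \<in> parcs (induced \<Gamma> W)" if "(u, v) \<in> parcs (induced \<Gamma> W)" for u v
    using that pair_graph_parcs(4)[OF assms(1), of u v] by (simp add: induced_def)
qed (auto simp: induced_def)

lemma iso_by_induced:
  assumes "iso_by \<phi> \<Gamma> \<Delta>" "W \<subseteq> pverts \<Gamma>"
  shows "iso_by \<phi> (induced \<Gamma> W) (induced \<Delta> (\<phi> ` W))"
proof -
  have \<Gamma>: "pair_graph \<Gamma>" and bij: "bij_betw \<phi> (pverts \<Gamma>) (pverts \<Delta>)"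
    and A: "parcs \<Delta> = map_prod \<phi> \<phi> ` parcs \<Gamma>"
    using assms by (auto simp: iso_by_def)
  have inj: "inj_on \<phi> (pverts \<Gamma>)" using bij by (simp add: bij_betw_def)
  have mem: "\<phi> u \<in> \<phi> ` W \<longleftrightarrow> u \<in> W" if "u \<in> pverts \<Gamma>" for u
    using inj_on_image_mem_iff[OF inj that assms(2)] .
  have "{(u, v) \<in> map_prod \<phi> \<phi> ` parcs \<Gamma>. u \<in> \<phi> ` W \<and> v \<in> \<phi> ` W} =
      map_prod \<phi> \<phi> ` {(u, v) \<in> parcs \<Gamma>. u \<in> W \<and> v \<in> W}" (is "?L = ?R")
  proof
    show "?L \<subseteq> ?R"
    proof
      fix p assume "p \<in> ?L"
      then have "p \<in> map_prod \<phi> \<phi> ` parcs \<Gamma>" and W: "fst p \<in> \<phi> ` W" "snd p \<in> \<phi> ` W"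
        by (simp_all add: case_prod_unfold)
      then obtain x y where a: "(x, y) \<in> parcs \<Gamma>" "p = (\<phi> x, \<phi> y)" by auto
      have "\<phi> x \<in> \<phi> ` W" "\<phi> y \<in> \<phi> ` W" using W unfolding a(2) by simp_all
      moreover have "x \<in> pverts \<Gamma>" "y \<in> pverts \<Gamma>" using a(1) pair_graph_parcs(2)[OF \<Gamma>] by auto
      ultimately have "x \<in> W" "y \<in> W" using mem by simp_all
      with a show "p \<in> ?R" by (auto intro!: rev_image_eqI[of "(x, y)"])
    qed
  qed auto
  moreover have "bij_betw \<phi> W (\<phi> ` W)"
    using inj assms(2) by (auto simp: bij_betw_def intro: inj_on_subset)
  ultimately show ?thesis
    using pair_graph_induced[OF \<Gamma> assms(2)] by (simp add: iso_by_def induced_def A)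
qed

lemma tube_iso_by:
  assumes "iso_by \<phi> \<Gamma> \<Delta>" "W \<subseteq> pverts \<Gamma>"
  shows "tube \<Delta> (\<phi> ` W) \<longleftrightarrow> tube \<Gamma> W"
proof -
  have "Digraph_Component.connected (with_proj (induced \<Delta> (\<phi> ` W))) \<longleftrightarrow>
      Digraph_Component.connected (with_proj (induced \<Gamma> W))"
    using iso_by_induced[OF assms] iso_by_sym iso_by_graph_iso connected_graph_iso by metis
  moreover have "\<phi> ` W \<subseteq> pverts \<Delta>"
    using assms by (auto simp: iso_by_def bij_betw_def)
  ultimately show ?thesis using assms(2) by (simp add: tube_def)
qed

lemma tube_partition_iso_by:
  assumes "iso_by \<phi> \<Gamma> \<Delta>" "tube_partition \<Gamma> I"
  shows "tube_partition \<Delta> ((`) \<phi> ` I)"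
proof -
  have I: "partition_on (pverts \<Gamma>) I" "\<And>W. W \<in> I \<Longrightarrow> tube \<Gamma> W"
    using assms(2) by (auto simp: tube_partition_def)
  have "inj_on \<phi> (pverts \<Gamma>)" "\<phi> ` pverts \<Gamma> = pverts \<Delta>"
    using assms(1) by (auto simp: iso_by_def bij_betw_def)
  moreover have "{} \<notin> (`) \<phi> ` I" using partition_onD3[OF I(1)] by auto
  ultimately have "partition_on (pverts \<Delta>) ((`) \<phi> ` I)"
    using partition_on_inj_image[OF I(1), of \<phi>] by simp
  moreover have "tube \<Delta> (\<phi> ` W)" if "W \<in> I" for W
  proof -
    have "W \<subseteq> pverts \<Gamma>" using I(2)[OF that] by (simp add: tube_def)
    then show ?thesis using I(2)[OF that] tube_iso_by[OF assms(1)] by simp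
  qed
  ultimately show ?thesis by (auto simp: tube_partition_def)
qed

lemma pair_graph_contraction:
  assumes "finite I"
  shows "pair_graph (contraction \<Gamma> I)"
proof (rule pair_graphI)
  show "(B, A) \<in> parcs (contraction \<Gamma> I)" if "(A, B) \<in> parcs (contraction \<Gamma> I)" for A B
    using that Un_commute[of B A] by (simp add: contraction_def eq_commute)
qed (use assms in \<open>auto simp: contraction_def\<close>)

lemma iso_by_contraction:
  assumes "iso_by \<phi> \<Gamma> \<Delta>" "tube_partition \<Gamma> I"
  shows "iso_by ((`) \<phi>) (contraction \<Gamma> I) (contraction \<Delta> ((`) \<phi> ` I))"
proof -
  have \<Gamma>: "pair_graph \<Gamma>" and inj: "inj_on \<phi> (pverts \<Gamma>)"
    using assms by (auto simp: iso_by_def bij_betw_def)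
  have I: "partition_on (pverts \<Gamma>) I" using assms(2) by (simp add: tube_partition_def)
  have sub: "W \<subseteq> pverts \<Gamma>" if "W \<in> I" for W
    using I that by (auto simp: partition_on_def)
  have injI: "inj_on ((`) \<phi>) I"
    using inj_on_image_Pow[OF inj] by (rule inj_on_subset) (use sub in blast)
  have eq: "\<phi> ` A = \<phi> ` B \<longleftrightarrow> A = B" if "A \<in> I" "B \<in> I" for A B
    using injI that by (auto dest: inj_onD)
  have tube: "tube \<Delta> (\<phi> ` A \<union> \<phi> ` B) \<longleftrightarrow> tube \<Gamma> (A \<union> B)" if "A \<in> I" "B \<in> I" for A B
    using tube_iso_by[OF assms(1), of "A \<union> B"] sub[OF that(1)] sub[OF that(2)] by (simp add: image_Un)
  have "{(A, B). A \<in> (`) \<phi> ` I \<and> B \<in> (`) \<phi> ` I \<and> A \<noteq> B \<and> tube \<Delta> (A \<union> B)} =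
      map_prod ((`) \<phi>) ((`) \<phi>) ` {(A, B). A \<in> I \<and> B \<in> I \<and> A \<noteq> B \<and> tube \<Gamma> (A \<union> B)}" (is "?L = ?R")
  proof
    show "?L \<subseteq> ?R"
    proof clarify
      fix A B assume "A \<in> I" "B \<in> I" "\<phi> ` A \<noteq> \<phi> ` B" "tube \<Delta> (\<phi> ` A \<union> \<phi> ` B)"
      then show "(\<phi> ` A, \<phi> ` B) \<in> ?R"
        using tube by (intro rev_image_eqI[of "(A, B)"]) auto
    qed
    show "?R \<subseteq> ?L" using tube eq by auto
  qed
  moreover have "finite I" using finite_elements[OF pair_graph_parcs(1)[OF \<Gamma>] I] .
  ultimately show ?thesis
    using pair_graph_contraction[of I \<Gamma>] injI by (simp add: iso_by_def bij_betw_def contraction_def)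
qed

text \<open>Carries the defining formula of the product from graphs on the naturals to any vertex
  type. The sum for the chosen copy is reindexed along an isomorphism: blocks are tubes, hence
  connected, and fall under \<open>gval_eq\<close>, while contractions go through
  \<open>gval_iso\<close>.\<close>

lemma gval_graphic_prod:
  assumes \<Gamma>: "pair_graph \<Gamma>" and g: "graphic g"
  shows "gval (graphic_prod f g) \<Gamma> =
    (\<Sum>I | tube_partition \<Gamma> I. gval f (contraction \<Gamma> I) * (\<Prod>W\<in>I. gval g (induced \<Gamma> W)))"
proof -
  define \<Delta> :: "nat pair_pre_digraph" where "\<Delta> = (SOME \<Delta>. graph_iso \<Gamma> \<Delta>)"
  have "graph_iso \<Gamma> \<Delta>" unfolding \<Delta>_def using ex_nat_copy[OF \<Gamma>] by (rule someI_ex)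
  then obtain \<phi> where \<phi>: "iso_by \<phi> \<Gamma> \<Delta>" using graph_iso_iso_by[OF \<Gamma>] by blast
  let ?\<psi> = "the_inv_into (pverts \<Gamma>) \<phi>"
  have inj: "inj_on \<phi> (pverts \<Gamma>)" and im: "\<phi> ` pverts \<Gamma> = pverts \<Delta>"
    using \<phi> by (auto simp: iso_by_def bij_betw_def)
  have sub: "W \<subseteq> pverts \<Lambda>" if "tube_partition \<Lambda> I" "W \<in> I"
    for \<Lambda> :: "'c pair_pre_digraph" and I W
    using that by (auto simp: tube_partition_def partition_on_def)
  have inv1: "?\<psi> ` \<phi> ` W = W" if "W \<subseteq> pverts \<Gamma>" for W
    unfolding image_image using that by (simp add: the_inv_into_f_f[OF inj] subset_iff cong: image_cong)
  have inv2: "\<phi> ` ?\<psi> ` W = W" if "W \<subseteq> pverts \<Delta>" for W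
    unfolding image_image using that by (simp add: f_the_inv_into_f[OF inj] im subset_iff cong: image_cong)
  have "(\<Sum>I | tube_partition \<Gamma> I. gval f (contraction \<Gamma> I) * (\<Prod>W\<in>I. gval g (induced \<Gamma> W))) =
      (\<Sum>J | tube_partition \<Delta> J. gval f (contraction \<Delta> J) * (\<Prod>W\<in>J. g (induced \<Delta> W)))"
  proof (rule sum.reindex_bij_witness[of _ "(`) ((`) ?\<psi>)" "(`) ((`) \<phi>)"])
    fix I assume "I \<in> {I. tube_partition \<Gamma> I}"
    then have I: "tube_partition \<Gamma> I" by simp
    show "(`) ?\<psi> ` (`) \<phi> ` I = I"
      unfolding image_image[of "(`) ?\<psi>"] using inv1[OF sub[OF I]] by (simp cong: image_cong)
    show "(`) \<phi> ` I \<in> {J. tube_partition \<Delta> J}"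
      using tube_partition_iso_by[OF \<phi> I] by simp
    have "gval f (contraction \<Gamma> I) = gval f (contraction \<Delta> ((`) \<phi> ` I))"
      using iso_by_contraction[OF \<phi> I] by (intro gval_iso iso_by_graph_iso) (auto simp: iso_by_def)
    moreover have "inj_on ((`) \<phi>) I"
      using inj_on_image_Pow[OF inj] by (rule inj_on_subset) (use sub[OF I] in blast)
    moreover have "gval g (induced \<Gamma> W) = g (induced \<Delta> (\<phi> ` W))" if "W \<in> I" for W
    proof (rule gval_eq[OF g])
      have "tube \<Gamma> W" using I that by (simp add: tube_partition_def)
      then show "connected_graph (induced \<Gamma> W)"
        using pair_graph_induced[OF \<Gamma>] by (simp add: connected_graph_def tube_def)
      show "graph_iso (induced \<Gamma> W) (induced \<Delta> (\<phi> ` W))"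
        using iso_by_graph_iso[OF iso_by_induced[OF \<phi> sub[OF I that]]] .
    qed
    ultimately show "gval f (contraction \<Delta> ((`) \<phi> ` I)) * (\<Prod>W\<in>(`) \<phi> ` I. g (induced \<Delta> W)) =
        gval f (contraction \<Gamma> I) * (\<Prod>W\<in>I. gval g (induced \<Gamma> W))"
      by (simp add: prod.reindex cong: prod.cong)
  next
    fix J assume "J \<in> {J. tube_partition \<Delta> J}"
    then have J: "tube_partition \<Delta> J" by simp
    show "(`) \<phi> ` (`) ?\<psi> ` J = J"
      unfolding image_image[of "(`) \<phi>"] using inv2[OF sub[OF J]] by (simp cong: image_cong)
    show "(`) ?\<psi> ` J \<in> {I. tube_partition \<Gamma> I}"
      using tube_partition_iso_by[OF iso_by_sym[OF \<phi>] J] by simp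
  qed
  then show ?thesis by (simp add: gval_def[of "graphic_prod f g"] graphic_prod_def \<Delta>_def)
qed

text \<open>A colouring replaces the list of part sizes because colourings restrict to subsets and,
  as shown below for coloured graphs, pass to contractions.\<close>

definition multipartite :: "('v \<Rightarrow> 'c) \<Rightarrow> 'v set \<Rightarrow> 'v pair_pre_digraph" where
  "multipartite c V = \<lparr>pverts = V, parcs = {(u, v). u \<in> V \<and> v \<in> V \<and> c u \<noteq> c v}\<rparr>"

lemma pair_graph_multipartite: "finite V \<Longrightarrow> pair_graph (multipartite c V)"
  by (rule pair_graphI) (auto simp: multipartite_def)

lemma induced_multipartite: "W \<subseteq> V \<Longrightarrow> induced (multipartite c V) W = multipartite c W"
  by (auto simp: induced_def multipartite_def)

text \<open>Vertices of different colours are adjacent, and two of the same colour have a common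
  neighbour as soon as a second colour occurs. With a single colour there are no arcs, so only a
  one-element set is connected.\<close>

lemma connected_multipartite:
  "Digraph_Component.connected (with_proj (multipartite c V)) \<longleftrightarrow>
    (\<exists>u\<in>V. \<exists>v\<in>V. c u \<noteq> c v) \<or> (\<exists>v. V = {v})"
proof -
  let ?E = "{(u, v). u \<in> V \<and> v \<in> V \<and> c u \<noteq> c v}"
  have "?E\<^sup>s = ?E" by (auto simp: symcl_def)
  then have conv: "Digraph_Component.connected (with_proj (multipartite c V)) \<longleftrightarrow>
      V \<noteq> {} \<and> (\<forall>u\<in>V. \<forall>v\<in>V. (u, v) \<in> rtrancl_on V ?E)"
    by (simp add: connected_conv multipartite_def)
  show ?thesis
  proof (cases "\<exists>u\<in>V. \<exists>v\<in>V. c u \<noteq> c v")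
    case True
    then obtain x y where xy: "x \<in> V" "y \<in> V" "c x \<noteq> c y" by blast
    have adj: "(u, v) \<in> rtrancl_on V ?E" if "u \<in> V" "v \<in> V" "c u \<noteq> c v" for u v
      by (rule rtrancl_on_into_rtrancl_on[OF rtrancl_on_refl]) (use that in auto)
    have "(u, v) \<in> rtrancl_on V ?E" if uv: "u \<in> V" "v \<in> V" for u v
    proof (cases "c u = c v")
      case True
      obtain w where "w \<in> V" "c u \<noteq> c w" using xy by metis
      then show ?thesis using uv True by (intro rtrancl_on_trans[OF adj adj]) auto
    qed (use uv adj in blast)
    then show ?thesis unfolding conv using True by blast
  next
    case False
    then have E: "?E = {}" by blast
    have "u = v" if "(u, v) \<in> rtrancl_on V {}" for u v
      using that by (induction rule: rtrancl_on.induct) simp_all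
    then have "(u, v) \<in> rtrancl_on V {} \<longleftrightarrow> u = v" if "u \<in> V" for u v
      using that rtrancl_on_refl by metis
    then have "Digraph_Component.connected (with_proj (multipartite c V)) \<longleftrightarrow> V \<noteq> {} \<and> (\<forall>u\<in>V. \<forall>v\<in>V. u = v)"
      unfolding conv E by simp
    also have "\<dots> \<longleftrightarrow> (\<exists>v. V = {v})" by blast
    finally show ?thesis using False by blast
  qed
qed

lemma iso_by_multipartite:
  assumes "finite V" "bij_betw h V V'" and c: "\<And>u v. u \<in> V \<Longrightarrow> v \<in> V \<Longrightarrow> c' (h u) = c' (h v) \<longleftrightarrow> c u = c v"
  shows "iso_by h (multipartite c V) (multipartite c' V')"
proof -
  have "{(u, v). u \<in> V' \<and> v \<in> V' \<and> c' u \<noteq> c' v} = map_prod h h ` {(u, v). u \<in> V \<and> v \<in> V \<and> c u \<noteq> c v}"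
    (is "?L = ?R")
  proof
    show "?L \<subseteq> ?R"
    proof clarify
      fix u v assume uv: "u \<in> V'" "v \<in> V'" "c' u \<noteq> c' v"
      then obtain x y where xy: "x \<in> V" "y \<in> V" "u = h x" "v = h y"
        using assms(2) by (auto simp: bij_betw_def)
      then show "(u, v) \<in> ?R" using uv(3) c by (intro rev_image_eqI[of "(x, y)"]) auto
    qed
    show "?R \<subseteq> ?L" using assms(2) c by (auto simp: bij_betw_def)
  qed
  then show ?thesis
    using assms(1,2) pair_graph_multipartite[of V c] by (simp add: iso_by_def multipartite_def)
qed

lemma image_mset_eq_mset:
  "image_mset s M = mset \<nu> \<Longrightarrow> \<exists>ks. mset ks = M \<and> map s ks = \<nu>"
proof (induction \<nu> arbitrary: M)
  case Nil
  then show ?case by simp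
next
  case (Cons a \<nu>)
  then have "image_mset s M = add_mset a (mset \<nu>)" by simp
  from msed_map_invR[OF this] obtain N k where N: "M = add_mset k N" "s k = a" "image_mset s N = mset \<nu>"
    by blast
  from Cons.IH[OF N(3)] obtain ks where "mset ks = N" "map s ks = \<nu>" by blast
  with N show ?case by (intro exI[of _ "k # ks"]) simp
qed

text \<open>A vertex goes to the pair of the position of its colour, in an enumeration whose class
  sizes read \<nu>, and its number within its colour class.\<close>

lemma graph_iso_complete_multipartite:
  assumes V: "finite V" and \<nu>: "image_mset (\<lambda>k. card {v\<in>V. c v = k}) (mset_set (c ` V)) = mset \<nu>"
  shows "graph_iso (multipartite c V) (complete_multipartite \<nu>)"
proof -
  let ?fib = "\<lambda>k. {v\<in>V. c v = k}"
  from image_mset_eq_mset[OF \<nu>] obtain ks where ks: "mset ks = mset_set (c ` V)" "map (\<lambda>k. card (?fib k)) ks = \<nu>"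
    by blast
  have set: "set ks = c ` V" using ks(1) V by (metis finite_imageI finite_set_mset_mset_set set_mset_mset)
  have dist: "distinct ks" using ks(1) V
    by (simp add: distinct_count_atmost_1 set count_mset_set')
  have len: "length ks = length \<nu>" using ks(2) by auto
  have nth: "\<nu> ! i = card (?fib (ks ! i))" if "i < length \<nu>" for i
    using nth_map[of i ks "\<lambda>k. card (?fib k)"] that by (simp only: ks(2) len)
  define idx where "idx = the_inv_into {..<length \<nu>} (nth ks)"
  have bij: "bij_betw (nth ks) {..<length \<nu>} (c ` V)"
    using bij_betw_nth[OF dist, of "{..<length \<nu>}"] set len by simp
  have idx: "idx k < length \<nu>" "ks ! idx k = k" if "k \<in> c ` V" for k
    using bij_betw_the_inv_into[OF bij] f_the_inv_into_f_bij_betw[OF bij] that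
    unfolding idx_def bij_betw_def by auto
  have idx': "idx (ks ! i) = i" if "i < length \<nu>" for i
    using bij that unfolding idx_def by (simp add: bij_betw_def the_inv_into_f_f)
  have "\<exists>h. bij_betw h (?fib k) {0..<card (?fib k)}" for k
    using V by (intro ex_bij_betw_finite_nat) simp
  then have "\<forall>k. \<exists>h. bij_betw h (?fib k) {0..<card (?fib k)}" by (rule allI)
  from choice[OF this] obtain h where "\<forall>k. bij_betw (h k) (?fib k) {0..<card (?fib k)}" ..
  then have h: "bij_betw (h k) (?fib k) {0..<card (?fib k)}" for k by (rule spec)
  define H where "H = (\<lambda>v. (idx (c v), h (c v) v))"
  let ?V' = "{(i, j). i < length \<nu> \<and> j < \<nu> ! i}"
  have "bij_betw H V ?V'"
  proof (rule bij_betwI')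
    fix u v assume uv: "u \<in> V" "v \<in> V"
    show "H u = H v \<longleftrightarrow> u = v"
    proof
      assume eq: "H u = H v"
      then have "c u = c v" using idx(2) uv by (metis H_def fst_conv image_eqI)
      moreover from this eq have "h (c v) u = h (c v) v" by (simp add: H_def)
      ultimately show "u = v"
        using h[of "c v"] uv by (auto simp: bij_betw_def dest!: inj_onD)
    qed simp
  next
    fix v assume v: "v \<in> V"
    then have "h (c v) v \<in> {0..<card (?fib (c v))}"
      using h[of "c v"] by (auto simp: bij_betw_def)
    then show "H v \<in> ?V'"
      using idx[of "c v"] nth[of "idx (c v)"] v by (simp add: H_def)
  next
    fix p assume "p \<in> ?V'"
    then obtain i j where p: "p = (i, j)" and i: "i < length \<nu>" and j: "j < card (?fib (ks ! i))"
      using nth by auto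
    have "j \<in> h (ks ! i) ` ?fib (ks ! i)"
      unfolding bij_betw_imp_surj_on[OF h] using j by simp
    then obtain v where "v \<in> ?fib (ks ! i)" "h (ks ! i) v = j" by blast
    then show "\<exists>v\<in>V. p = H v"
      using p idx'[OF i] by (intro bexI[of _ v]) (auto simp: H_def)
  qed
  moreover have "fst (H u) = fst (H v) \<longleftrightarrow> c u = c v" if "u \<in> V" "v \<in> V" for u v
    using that idx(2) by (metis H_def fst_conv image_eqI)
  ultimately have "iso_by H (multipartite c V) (multipartite fst ?V')"
    using V by (intro iso_by_multipartite) auto
  moreover have "multipartite fst ?V' = complete_multipartite \<nu>"
    by (simp add: multipartite_def complete_multipartite_def Let_def)
  ultimately show ?thesis using iso_by_graph_iso by metis
qed

section \<open>Coefficients of the Young generating function\<close>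

lemma lookup_xtype:
  assumes "finite V"
  shows "Poly_Mapping.lookup (xtype col V) i = card {v\<in>V. col v = Some i}"
  using assms
proof (induction V rule: finite_induct)
  case empty
  show ?case by (simp add: xtype_def)
next
  case (insert v V)
  have "{u \<in> insert v V. col u = Some i} =
      (if col v = Some i then insert v {u\<in>V. col u = Some i} else {u\<in>V. col u = Some i})" by auto
  moreover have "xtype col (insert v V) = (case col v of None \<Rightarrow> 0 | Some k \<Rightarrow> Poly_Mapping.single k 1) + xtype col V"
    using insert.hyps by (simp add: xtype_def)
  ultimately show ?case
    using insert by (simp add: lookup_add lookup_single when_def split: option.split)
qed

lemma keys_xtype:
  assumes "finite V"
  shows "Poly_Mapping.keys (xtype col V) = {i. Some i \<in> col ` V}"
proof -
  have "Poly_Mapping.lookup (xtype col V) i \<noteq> 0 \<longleftrightarrow> Some i \<in> col ` V" for i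
    unfolding lookup_xtype[OF assms] using assms by (force simp: image_iff)
  then show ?thesis by (auto simp: in_keys_iff)
qed

lemma ztype_eq_0: "\<forall>v\<in>V. col v \<noteq> None \<Longrightarrow> ztype col V = 0"
proof -
  assume "\<forall>v\<in>V. col v \<noteq> None"
  then have "{v\<in>V. col v = None} = {}" by blast
  then show ?thesis by (simp only: ztype_def card.empty)
qed

text \<open>The one partition whose monomial symmetric function contains the monomial with exponents
  \<alpha>.\<close>

definition exponent_partition :: "(nat \<Rightarrow>\<^sub>0 nat) \<Rightarrow> nat list" where
  "exponent_partition \<alpha> = rev (sorted_list_of_multiset
     (image_mset (Poly_Mapping.lookup \<alpha>) (mset_set (Poly_Mapping.keys \<alpha>))))"

lemma mset_exponent_partition: "mset (exponent_partition \<alpha>) = image_mset (Poly_Mapping.lookup \<alpha>) (mset_set (Poly_Mapping.keys \<alpha>))"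
  by (simp add: exponent_partition_def)

lemma length_exponent_partition: "length (exponent_partition \<alpha>) = card (Poly_Mapping.keys \<alpha>)"
  using arg_cong[OF mset_exponent_partition[of \<alpha>], of size] by simp

lemma fact_partition_exponent_partition: "fact_partition (exponent_partition \<alpha>) = xfact \<alpha>"
proof -
  have "fact_partition (exponent_partition \<alpha>) = prod_mset (image_mset fact (mset (exponent_partition \<alpha>)))"
    unfolding fact_partition_def by (metis mset_map prod_mset_prod_list)
  also have "\<dots> = xfact \<alpha>"
    unfolding mset_exponent_partition xfact_def prod_unfold_prod_mset by (simp add: multiset.map_comp comp_def)
  finally show ?thesis .
qed

lemma exponent_partition_eqI:
  assumes "\<mu> \<in> partitions" "mset \<mu> = image_mset (Poly_Mapping.lookup \<alpha>) (mset_set (Poly_Mapping.keys \<alpha>))"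
  shows "\<mu> = exponent_partition \<alpha>"
proof -
  have "sorted (rev \<mu>)" using assms(1) by (simp add: partitions_def sorted_wrt_rev)
  then have "sort \<mu> = rev \<mu>" by (intro properties_for_sort) simp_all
  then have "rev \<mu> = rev (exponent_partition \<alpha>)"
    using sorted_list_of_multiset_mset[of \<mu>] by (simp add: assms(2) exponent_partition_def)
  then show ?thesis by simp
qed

lemma exponent_partition_in_partitions: "exponent_partition \<alpha> \<in> partitions"
proof -
  have "set (exponent_partition \<alpha>) = Poly_Mapping.lookup \<alpha> ` Poly_Mapping.keys \<alpha>"
    using arg_cong[OF mset_exponent_partition[of \<alpha>], of set_mset] by simp
  then have "0 \<notin> set (exponent_partition \<alpha>)" by (auto simp: in_keys_iff)
  moreover have "sorted_wrt (\<ge>) (exponent_partition \<alpha>)"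
    by (simp add: exponent_partition_def sorted_wrt_rev)
  ultimately show ?thesis by (simp add: partitions_def)
qed

text \<open>Every monomial occurs in precisely one monomial symmetric function, with coefficient 1,
  so at most one term of the sum survives.\<close>

lemma xcoeff_xsum_msym:
  fixes c :: "nat list \<Rightarrow> 'r::{comm_ring, comm_monoid_mult}"
  assumes "A \<subseteq> partitions"
  shows "xcoeff (xsum (\<lambda>\<mu>. xscale (c \<mu>) (msym \<mu>)) A) \<alpha> = (if exponent_partition \<alpha> \<in> A then c (exponent_partition \<alpha>) else 0)"
proof -
  let ?u = "\<lambda>\<mu>. xcoeff (xscale (c \<mu>) (msym \<mu>)) \<alpha>"
  have u: "?u \<mu> = (if \<mu> = exponent_partition \<alpha> then c \<mu> else 0)" if "\<mu> \<in> partitions" for \<mu>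
  proof (cases "\<mu> = exponent_partition \<alpha>")
    case True
    then show ?thesis by (simp add: xscale_def msym_def mset_exponent_partition)
  next
    case False
    then have "image_mset (Poly_Mapping.lookup \<alpha>) (mset_set (Poly_Mapping.keys \<alpha>)) \<noteq> mset \<mu>"
      using exponent_partition_eqI[OF that] by metis
    then show ?thesis using False by (simp add: xscale_def msym_def)
  qed
  have "xcoeff (xsum (\<lambda>\<mu>. xscale (c \<mu>) (msym \<mu>)) A) \<alpha> = (\<Sum>\<mu> | \<mu> \<in> A \<and> ?u \<mu> \<noteq> 0. ?u \<mu>)"
    by (simp add: xsum_def)
  also have "\<dots> = (\<Sum>\<mu>\<in>A \<inter> {exponent_partition \<alpha>}. ?u \<mu>)"
  proof (rule sum.mono_neutral_left)
    show "{\<mu>. \<mu> \<in> A \<and> ?u \<mu> \<noteq> 0} \<subseteq> A \<inter> {exponent_partition \<alpha>}"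
    proof
      fix \<mu> assume \<mu>: "\<mu> \<in> {\<mu>. \<mu> \<in> A \<and> ?u \<mu> \<noteq> 0}"
      then have "\<mu> \<in> partitions" using assms by blast
      from \<mu> u[OF this] show "\<mu> \<in> A \<inter> {exponent_partition \<alpha>}" by (cases "\<mu> = exponent_partition \<alpha>") simp_all
    qed
  qed auto
  also have "\<dots> = (if exponent_partition \<alpha> \<in> A then c (exponent_partition \<alpha>) else 0)"
    using u[OF exponent_partition_in_partitions] by simp
  finally show ?thesis .
qed

text \<open>The denominators of the Young generating function are exactly these factorials. The
  condition stems from the bound on the length in the part free of \<open>z\<close>, the length
  being the number of variables that occur.\<close>

lemma young_gf_coeff:
  "nmult (xfact \<alpha> * fact n) (xcoeff (fps_nth (young_gf f) n) \<alpha>) =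
    (if n > 0 \<or> 2 \<le> card (Poly_Mapping.keys \<alpha>)
     then qemb (gval f (complete_multipartite (exponent_partition \<alpha> @ replicate n 1))) else 0)"
proof -
  let ?c = "\<lambda>n \<mu>. gval f (complete_multipartite (\<mu> @ replicate n 1))"
  have "xcoeff (fps_nth (young_gf f) n) \<alpha> =
    (if n > 0 \<or> 2 \<le> card (Poly_Mapping.keys \<alpha>) then qfrac (?c n (exponent_partition \<alpha>)) (xfact \<alpha> * fact n) else 0)"
  proof (cases "n = 0")
    case True
    have "xcoeff (fps_nth (young_gf f) 0) \<alpha> =
        xcoeff (xsum (\<lambda>\<mu>. xscale (qfrac (?c 0 \<mu>) (fact_partition \<mu>)) (msym \<mu>)) {\<mu> \<in> partitions. length \<mu> \<ge> 2}) \<alpha>"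
      by (simp add: young_gf_def)
    also have "\<dots> = (if 2 \<le> card (Poly_Mapping.keys \<alpha>) then qfrac (?c 0 (exponent_partition \<alpha>)) (xfact \<alpha>) else 0)"
      by (subst xcoeff_xsum_msym) (auto simp: length_exponent_partition exponent_partition_in_partitions fact_partition_exponent_partition)
    finally show ?thesis by (simp add: True)
  next
    case False
    then have "xcoeff (fps_nth (young_gf f) n) \<alpha> =
        xcoeff (xsum (\<lambda>\<mu>. xscale (qfrac (?c n \<mu>) (fact_partition \<mu> * fact n)) (msym \<mu>)) partitions) \<alpha>"
      by (simp add: young_gf_def)
    also have "\<dots> = qfrac (?c n (exponent_partition \<alpha>)) (xfact \<alpha> * fact n)"
      by (subst xcoeff_xsum_msym) (auto simp: exponent_partition_in_partitions fact_partition_exponent_partition)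
    finally show ?thesis using False by simp
  qed
  moreover have "nmult (xfact \<alpha> * fact n) (qfrac a (xfact \<alpha> * fact n)) = qemb a" for a :: 'a
    using nmult_qfrac_cancel[of "xfact \<alpha> * fact n" 1 a] xfact_pos[of \<alpha>] by simp
  ultimately show ?thesis by simp
qed

text \<open>Every vertex coloured \<open>None\<close> is an independent block of its own.\<close>

definition vpart :: "('v \<Rightarrow> nat option) \<Rightarrow> 'v \<Rightarrow> nat + 'v" where
  "vpart col v = (case col v of None \<Rightarrow> Inr v | Some i \<Rightarrow> Inl i)"

lemma vpart_eq_iff: "vpart col u = vpart col v \<longleftrightarrow> col u = col v \<and> (col u = None \<longrightarrow> u = v)"
  by (auto simp: vpart_def split: option.splits)

definition coloured_graph :: "('v \<Rightarrow> nat option) \<Rightarrow> 'v set \<Rightarrow> 'v pair_pre_digraph" where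
  "coloured_graph col V = multipartite (vpart col) V"

lemma pair_graph_coloured_graph: "finite V \<Longrightarrow> pair_graph (coloured_graph col V)"
  by (simp add: coloured_graph_def pair_graph_multipartite)

lemma gval_coloured_graph:
  fixes col :: "'v \<Rightarrow> nat option"
  assumes V: "finite V"
  shows "gval f (coloured_graph col V) =
    gval f (complete_multipartite (exponent_partition (xtype col V) @ replicate (ztype col V) 1))"
proof (rule gval_iso)
  let ?K = "Poly_Mapping.keys (xtype col V)" and ?Z = "{v\<in>V. col v = None}"
  let ?s = "\<lambda>k. card {v\<in>V. vpart col v = k}"
  \<comment> \<open>The parts are one for each variable that occurs, its size being the exponent,
    and one of size 1 for each vertex coloured \<open>None\<close>.\<close>
  have im: "vpart col ` V = Inl ` ?K \<union> Inr ` ?Z"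
  proof -
    have "vpart col v \<in> Inl ` ?K \<union> Inr ` ?Z" if "v \<in> V" for v
    proof (cases "col v")
      case (Some i)
      then have "i \<in> ?K" unfolding keys_xtype[OF V] using that by (metis imageI mem_Collect_eq)
      then show ?thesis using Some by (simp add: vpart_def)
    qed (use that in \<open>simp add: vpart_def\<close>)
    moreover have "Inl i \<in> vpart col ` V" if i: "i \<in> ?K" for i
    proof -
      obtain v where "v \<in> V" "col v = Some i" using i unfolding keys_xtype[OF V] by auto
      then show ?thesis by (intro rev_image_eqI[of v]) (simp_all add: vpart_def)
    qed
    moreover have "Inr v \<in> vpart col ` V" if "v \<in> ?Z" for v
      using that by (intro rev_image_eqI[of v]) (simp_all add: vpart_def)
    ultimately show ?thesis by blast
  qed
  have Inl: "?s (Inl i) = Poly_Mapping.lookup (xtype col V) i" for i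
    unfolding lookup_xtype[OF V] vpart_def by (rule arg_cong[where f = card]) (auto split: option.splits)
  have Inr: "?s (Inr z) = 1" if "z \<in> ?Z" for z
  proof -
    have "{v\<in>V. vpart col v = Inr z} = {z}"
      using that by (auto simp: vpart_def split: option.splits)
    then show ?thesis by simp
  qed
  have "image_mset ?s (mset_set (vpart col ` V)) =
      image_mset ?s (mset_set (Inl ` ?K)) + image_mset ?s (mset_set (Inr ` ?Z))"
    unfolding im using V by (subst mset_set_Union) auto
  also have "mset_set (Inl ` ?K :: (nat + 'v) set) = image_mset Inl (mset_set ?K)"
    by (rule image_mset_mset_set[symmetric]) simp
  also have "mset_set (Inr ` ?Z :: (nat + 'v) set) = image_mset Inr (mset_set ?Z)"
    by (rule image_mset_mset_set[symmetric]) simp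
  also have "image_mset ?s (image_mset Inl (mset_set ?K)) = mset (exponent_partition (xtype col V))"
    unfolding mset_exponent_partition multiset.map_comp comp_def Inl ..
  also have "image_mset ?s (image_mset Inr (mset_set ?Z)) = image_mset (\<lambda>_. 1) (mset_set ?Z)"
    unfolding multiset.map_comp comp_def by (rule image_mset_cong) (use V Inr in simp)
  also have "\<dots> = mset (replicate (ztype col V) 1)"
    by (simp add: ztype_def image_mset_const_eq)
  finally have "image_mset ?s (mset_set (vpart col ` V)) =
      mset (exponent_partition (xtype col V) @ replicate (ztype col V) 1)" by simp
  then show "graph_iso (coloured_graph col V) (complete_multipartite (exponent_partition (xtype col V) @ replicate (ztype col V) 1))"
    unfolding coloured_graph_def by (rule graph_iso_complete_multipartite[OF V])
qed (rule pair_graph_coloured_graph[OF V])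

text \<open>
  The non-empty coloured sets that induce a connected graph, except for a single vertex whose colour
  is a variable \<open>x\<^sub>i\<close>: the types of the monomials of a Young generating function.
\<close>

definition big :: "('v \<Rightarrow> nat option) \<Rightarrow> 'v set \<Rightarrow> bool" where
  "big col V \<longleftrightarrow> (\<exists>v\<in>V. col v = None) \<or> (\<exists>u\<in>V. \<exists>v\<in>V. col u \<noteq> col v)"

lemma big_mono: "big col W \<Longrightarrow> W \<subseteq> V \<Longrightarrow> big col V"
  unfolding big_def by blast

text \<open>Ties \<open>big\<close> to the condition in \<open>young_gf_coeff\<close>: if the colour
  \<open>None\<close> is absent, the variables that occur are the distinct colours in
  \<open>V\<close>.\<close>

lemma big_iff:
  assumes V: "finite V"
  shows "big col V \<longleftrightarrow> ztype col V > 0 \<or> 2 \<le> card (Poly_Mapping.keys (xtype col V))"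
proof (cases "\<exists>v\<in>V. col v = None")
  case True
  then have "ztype col V > 0" using V by (auto simp: ztype_def card_gt_0_iff)
  then show ?thesis using True by (simp add: big_def)
next
  case False
  then have "ztype col V = 0" by (intro ztype_eq_0) simp
  moreover have "card (Poly_Mapping.keys (xtype col V)) \<le> Suc 0 \<longleftrightarrow> (\<forall>u\<in>V. \<forall>v\<in>V. col u = col v)"
  proof -
    have "card (Poly_Mapping.keys (xtype col V)) \<le> Suc 0 \<longleftrightarrow>
        (\<forall>i. Some i \<in> col ` V \<longrightarrow> (\<forall>k. Some k \<in> col ` V \<longrightarrow> i = k))"
      by (subst card_le_Suc0_iff_eq[OF finite_keys]) (simp add: keys_xtype[OF V])
    also have "\<dots> \<longleftrightarrow> (\<forall>u\<in>V. \<forall>v\<in>V. col u = col v)"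
    proof (intro iffI ballI)
      fix u v assume *: "\<forall>i. Some i \<in> col ` V \<longrightarrow> (\<forall>k. Some k \<in> col ` V \<longrightarrow> i = k)"
        and uv: "u \<in> V" "v \<in> V"
      obtain i where i: "col u = Some i" using False uv(1) by (cases "col u") auto
      obtain k where k: "col v = Some k" using False uv(2) by (cases "col v") auto
      note ik = i k
      then have "Some i \<in> col ` V" "Some k \<in> col ` V" using uv by (metis imageI)+
      then show "col u = col v" using * ik by simp
    next
      assume *: "\<forall>u\<in>V. \<forall>v\<in>V. col u = col v"
      show "\<forall>i. Some i \<in> col ` V \<longrightarrow> (\<forall>k. Some k \<in> col ` V \<longrightarrow> i = k)"
      proof (intro allI impI)
        fix i k assume "Some i \<in> col ` V" "Some k \<in> col ` V"
        then obtain u v where "u \<in> V" "col u = Some i" "v \<in> V" "col v = Some k" by (metis imageE)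
        then show "i = k" using * by fastforce
      qed
    qed
    finally show ?thesis .
  qed
  moreover have "big col V \<longleftrightarrow> \<not> (\<forall>u\<in>V. \<forall>v\<in>V. col u = col v)"
    unfolding big_def using False by meson
  moreover have "2 \<le> card (Poly_Mapping.keys (xtype col V)) \<longleftrightarrow> \<not> card (Poly_Mapping.keys (xtype col V)) \<le> Suc 0"
    by linarith
  ultimately show ?thesis by (simp only: less_irrefl simp_thms)
qed

lemma lab_young_gf:
  assumes V: "finite V"
  shows "lab col (young_gf f) V = (if big col V then qemb (gval f (coloured_graph col V)) else 0)"
  unfolding lab_def young_gf_coeff big_iff[OF V] gval_coloured_graph[OF V] ..

text \<open>Here the power of \<open>z\<close> is not represented by elements of the set: the
  \<open>j\<close> parts of size 1 stand for the blocks of a partition of the complement, and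
  \<open>fact j\<close>, supplied by \<open>lab_pow\<close>, cancels the denominator at that
  power.\<close>

lemma lab_const_young_gf:
  assumes S: "finite S"
  shows "lab col (fps_const (nmult (fact j) (fps_nth (young_gf f) j))) S =
    (if (\<forall>v\<in>S. col v \<noteq> None) \<and> (j > 0 \<or> big col S)
     then qemb (gval f (complete_multipartite (exponent_partition (xtype col S) @ replicate j 1))) else 0)"
proof (cases "\<forall>v\<in>S. col v \<noteq> None")
  case True
  then have z: "ztype col S = 0" by (rule ztype_eq_0)
  have "lab col (fps_const (nmult (fact j) (fps_nth (young_gf f) j))) S =
      nmult (xfact (xtype col S) * fact j) (xcoeff (fps_nth (young_gf f) j) (xtype col S))"
    unfolding lab_const[OF S] if_P[OF True] xcoeff_nmult nmult_nmult ..
  then show ?thesis unfolding young_gf_coeff big_iff[OF S] z eqTrueI[OF True] by simp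
next
  case False
  then show ?thesis by (simp only: lab_const[OF S] simp_thms if_False)
qed

text \<open>A vertex coloured \<open>None\<close> is a part of its own and is joined to every other
  vertex, so \<open>big\<close> and connectedness can differ only on one-element sets.\<close>

lemma tube_coloured_graph:
  "tube (coloured_graph col V) W \<longleftrightarrow> W \<subseteq> V \<and> (big col W \<or> (\<exists>v. W = {v}))"
proof -
  have "(\<exists>u\<in>W. \<exists>v\<in>W. vpart col u \<noteq> vpart col v) \<or> (\<exists>v. W = {v}) \<longleftrightarrow> big col W \<or> (\<exists>v. W = {v})"
  proof (cases "\<exists>v. W = {v}")
    case False
    have "\<exists>u\<in>W. \<exists>w\<in>W. \<not> (col u = col w \<and> (col u = None \<longrightarrow> u = w))" if v: "v \<in> W" "col v = None" for v
    proof -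
      obtain u where "u \<in> W" "u \<noteq> v" using False v(1) by blast
      then show ?thesis using v by (intro bexI[of _ v] bexI[of _ u]) auto
    qed
    then show ?thesis unfolding vpart_eq_iff big_def by meson
  qed simp
  moreover have "tube (coloured_graph col V) W \<longleftrightarrow> W \<noteq> {} \<and> W \<subseteq> V \<and>
      ((\<exists>u\<in>W. \<exists>v\<in>W. vpart col u \<noteq> vpart col v) \<or> (\<exists>v. W = {v}))"
  proof (cases "W \<subseteq> V")
    case True
    then show ?thesis
      by (simp add: tube_def coloured_graph_def induced_multipartite connected_multipartite)
        (simp add: multipartite_def)
  next
    case False
    then show ?thesis by (simp add: tube_def coloured_graph_def multipartite_def)
  qed
  moreover have "W \<noteq> {}" if "big col W" using that by (auto simp: big_def)
  ultimately show ?thesis by blast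
qed

lemma induced_coloured_graph: "W \<subseteq> V \<Longrightarrow> induced (coloured_graph col V) W = coloured_graph col W"
  by (simp add: coloured_graph_def induced_multipartite)

text \<open>The colour of a block as a vertex of the contraction. A big block becomes adjacent to
  all others, hence \<open>None\<close>; \<open>the_elem\<close> is meant for the other blocks of a
  tube partition, which have one element.\<close>

definition block_colour :: "('v \<Rightarrow> nat option) \<Rightarrow> 'v set \<Rightarrow> nat option" where
  "block_colour col W = (if big col W then None else col (the_elem W))"

lemma block_colour_singleton: "block_colour col {v} = col v"
  by (auto simp: block_colour_def big_def)

text \<open>A union containing a big block is big, so a big block is adjacent to every other block.
  Blocks that are not big are single vertices coloured by variables, and the union of two of them is
  a tube iff the variables differ.\<close>

lemma contraction_coloured_graph:
  assumes "tube_partition (coloured_graph col V) I"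
  shows "contraction (coloured_graph col V) I = coloured_graph (block_colour col) I"
proof -
  have part: "partition_on V I" and I: "\<And>W. W \<in> I \<Longrightarrow> W \<subseteq> V \<and> (big col W \<or> (\<exists>v. W = {v}))"
    using assms by (simp_all add: tube_partition_def tube_coloured_graph) (simp add: coloured_graph_def multipartite_def)
  have "A \<noteq> B \<and> tube (coloured_graph col V) (A \<union> B) \<longleftrightarrow> vpart (block_colour col) A \<noteq> vpart (block_colour col) B"
    if AB: "A \<in> I" "B \<in> I" for A B
  proof (cases "A = B")
    case False
    have "A \<noteq> {}" "B \<noteq> {}" using partition_onD3[OF part] AB by (metis, metis)
    \<comment> \<open>Two distinct non-empty blocks cannot have a one-element union, so the union is
      a tube only by being big.\<close>
    then have "A \<union> B \<noteq> {v}" for v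
      using False by (metis Un_upper1 Un_upper2 subset_singletonD)
    then have tube: "tube (coloured_graph col V) (A \<union> B) \<longleftrightarrow> big col (A \<union> B)"
      using I[OF AB(1)] I[OF AB(2)] by (simp add: tube_coloured_graph)
    show ?thesis
    proof (cases "big col A \<or> big col B")
      case True
      then have "block_colour col A = None \<or> block_colour col B = None" by (auto simp: block_colour_def)
      moreover have "big col (A \<union> B)" using True big_mono by (metis Un_upper1 Un_upper2)
      ultimately show ?thesis using tube False by (auto simp: vpart_eq_iff)
    next
      case nb: False
      then obtain a b where ab: "A = {a}" "B = {b}" using I[OF AB(1)] I[OF AB(2)] by blast
      have "col a \<noteq> None" "col b \<noteq> None" using nb by (auto simp: ab big_def)
      then show ?thesis unfolding tube using False by (auto simp: ab vpart_eq_iff block_colour_singleton big_def)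
    qed
  qed simp
  then have "{(A, B). A \<in> I \<and> B \<in> I \<and> A \<noteq> B \<and> tube (coloured_graph col V) (A \<union> B)} =
      {(A, B). A \<in> I \<and> B \<in> I \<and> vpart (block_colour col) A \<noteq> vpart (block_colour col) B}"
    by (intro Collect_cong) (simp add: case_prod_unfold cong: conj_cong)
  then show ?thesis by (simp add: contraction_def coloured_graph_def multipartite_def)
qed

text \<open>The normalisation of a connected graphic function enters here: one-element blocks
  contribute a factor 1.\<close>

lemma gval_singleton:
  assumes "connected_graphic g"
  shows "gval g (coloured_graph col {v}) = 1"
proof -
  have "gval g (coloured_graph col {v}) = g single_vertex_graph"
  proof (rule gval_eq)
    show "graphic g" using assms by (simp add: connected_graphic_def)
    show "connected_graph (coloured_graph col {v})"
      using pair_graph_coloured_graph[of "{v}" col]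
      by (simp add: connected_graph_def) (simp add: coloured_graph_def connected_multipartite)
    have "iso_by (\<lambda>_. 0) (coloured_graph col {v}) single_vertex_graph"
      using pair_graph_coloured_graph[of "{v}" col]
      by (auto simp: iso_by_def coloured_graph_def multipartite_def single_vertex_graph_def bij_betw_def)
    then show "graph_iso (coloured_graph col {v}) single_vertex_graph" by (rule iso_by_graph_iso)
  qed
  then show ?thesis using assms by (simp add: connected_graphic_def)
qed

section \<open>Partitions into tubes\<close>

lemma big_singleton: "big col {v} \<longleftrightarrow> col v = None"
  by (simp add: big_def)

lemma pverts_coloured_graph: "pverts (coloured_graph col V) = V"
  by (simp add: coloured_graph_def multipartite_def)

lemma tube_partition_coloured_graph:
  "tube_partition (coloured_graph col V) I \<longleftrightarrow> partition_on V I \<and> (\<forall>W\<in>I. big col W \<or> (\<exists>v. W = {v}))"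
proof -
  have "W \<subseteq> V" if "partition_on V I" "W \<in> I" for W
    using that by (auto simp: partition_on_def)
  then show ?thesis
    unfolding tube_partition_def tube_coloured_graph pverts_coloured_graph by meson
qed

text \<open>
  A partition into tubes amounts to the set \<open>S\<close> of its one-element blocks of colour \<open>x\<^sub>i\<close> together
  with a partition \<open>P\<close> of the remaining vertices into big blocks, which take the place of the
  variable \<open>z\<close> in the contracted graph.
\<close>

definition big_partitions :: "('v \<Rightarrow> nat option) \<Rightarrow> 'v set \<Rightarrow> ('v set \<times> 'v set set) set" where
  "big_partitions col V = {(S, P). S \<subseteq> V \<and> partition_on (V - S) P \<and>
     (\<forall>v\<in>S. col v \<noteq> None) \<and> (\<forall>W\<in>P. big col W)}"

definition join_blocks :: "'v set \<times> 'v set set \<Rightarrow> 'v set set" where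
  "join_blocks = (\<lambda>(S, P). P \<union> (\<lambda>v. {v}) ` S)"

definition split_blocks :: "('v \<Rightarrow> nat option) \<Rightarrow> 'v set set \<Rightarrow> 'v set \<times> 'v set set" where
  "split_blocks col I = ({v. {v} \<in> I \<and> col v \<noteq> None}, {W\<in>I. big col W})"

lemma big_partitionsD:
  assumes "(S, P) \<in> big_partitions col V"
  shows "S \<subseteq> V" "partition_on (V - S) P" "v \<in> S \<Longrightarrow> col v \<noteq> None" "W \<in> P \<Longrightarrow> big col W"
    and "W \<in> P \<Longrightarrow> W \<subseteq> V - S" "v \<in> S \<Longrightarrow> {v} \<notin> P"
proof -
  show S: "S \<subseteq> V" and P: "partition_on (V - S) P"
    using assms by (simp_all add: big_partitions_def)
  have "\<forall>v\<in>S. col v \<noteq> None" "\<forall>W\<in>P. big col W"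
    using assms unfolding big_partitions_def by blast+
  then show "v \<in> S \<Longrightarrow> col v \<noteq> None" "W \<in> P \<Longrightarrow> big col W" by blast+
  show sub: "W \<subseteq> V - S" if "W \<in> P" for W
    using P that unfolding partition_on_def by blast
  show "v \<in> S \<Longrightarrow> {v} \<notin> P" using sub[of "{v}"] by blast
qed

text \<open>One-element blocks are told apart by their colour: those in \<open>P\<close> are big and
  hence coloured \<open>None\<close>, those from \<open>S\<close> are coloured by a
  variable.\<close>

lemma split_join_blocks:
  assumes "(S, P) \<in> big_partitions col V"
  shows "split_blocks col (join_blocks (S, P)) = (S, P)"
proof -
  note D = big_partitionsD[OF assms]
  have "{v} \<in> P \<union> (\<lambda>v. {v}) ` S \<and> col v \<noteq> None \<longleftrightarrow> v \<in> S" for v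
  proof
    assume *: "{v} \<in> P \<union> (\<lambda>v. {v}) ` S \<and> col v \<noteq> None"
    have "{v} \<notin> P" using D(4)[of "{v}"] * by (metis big_singleton)
    then show "v \<in> S" using * by blast
  next
    assume "v \<in> S"
    then show "{v} \<in> P \<union> (\<lambda>v. {v}) ` S \<and> col v \<noteq> None" using D(3)[of v] by blast
  qed
  moreover have "W \<in> P \<union> (\<lambda>v. {v}) ` S \<and> big col W \<longleftrightarrow> W \<in> P" for W
  proof
    assume *: "W \<in> P \<union> (\<lambda>v. {v}) ` S \<and> big col W"
    have "W \<noteq> {v}" if "v \<in> S" for v using * D(3)[OF that] big_singleton by metis
    then show "W \<in> P" using * by blast
  qed (use D(4) in blast)
  ultimately show ?thesis unfolding split_blocks_def join_blocks_def prod.case by simp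
qed

lemma tube_partition_join_blocks:
  assumes "(S, P) \<in> big_partitions col V"
  shows "tube_partition (coloured_graph col V) (join_blocks (S, P))"
proof -
  note D = big_partitionsD[OF assms]
  have "partition_on V (P \<union> (\<lambda>v. {v}) ` S)"
  proof (rule partition_onI)
    show "\<Union> (P \<union> (\<lambda>v. {v}) ` S) = V"
      using D(1) partition_onD1[OF D(2)] by auto
    show "disjnt A B" if AB: "A \<in> P \<union> (\<lambda>v. {v}) ` S" "B \<in> P \<union> (\<lambda>v. {v}) ` S" "A \<noteq> B" for A B
    proof (cases "A \<in> P \<and> B \<in> P")
      case True
      then show ?thesis
        using disjointD[OF partition_onD2[OF D(2)]] AB(3) by (simp add: disjnt_def)
    next
      case False
      have "A \<in> P \<or> (\<exists>a\<in>S. A = {a})" "B \<in> P \<or> (\<exists>b\<in>S. B = {b})" using AB(1,2) by auto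
      then show ?thesis using False D(5)[of A] D(5)[of B] AB(3) unfolding disjnt_def by blast
    qed
    show "{} \<notin> P \<union> (\<lambda>v. {v}) ` S"
      using partition_onD3[OF D(2)] by auto
  qed
  then show ?thesis
    unfolding tube_partition_coloured_graph join_blocks_def prod.case using D(4) by blast
qed

lemma split_blocks_big_partitions:
  assumes "tube_partition (coloured_graph col V) I"
  shows "split_blocks col I \<in> big_partitions col V" "join_blocks (split_blocks col I) = I"
proof -
  have part: "partition_on V I" and I: "\<And>W. W \<in> I \<Longrightarrow> big col W \<or> (\<exists>v. W = {v})"
    using assms by (simp_all add: tube_partition_coloured_graph)
  let ?S = "{v. {v} \<in> I \<and> col v \<noteq> None}" and ?P = "{W\<in>I. big col W}"
  have cover: "\<exists>W\<in>I. x \<in> W" if "x \<in> V" for x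
    using that unfolding partition_onD1[OF part] by blast
  \<comment> \<open>A block that is not big is a single vertex coloured by a variable, so it is
    accounted for by \<open>?S\<close>.\<close>
  have small: "\<exists>v\<in>?S. W = {v}" if W: "W \<in> I" "\<not> big col W" for W
  proof -
    obtain v where v: "W = {v}" using I[OF W(1)] W(2) by blast
    then have "col v \<noteq> None" using W(2) big_singleton[of col v] by simp
    then show ?thesis using v W(1) by blast
  qed
  have sub: "W \<subseteq> V" if "W \<in> I" for W
    using that part unfolding partition_on_def by blast
  have "\<Union> ?P = V - ?S"
  proof (rule set_eqI, rule iffI)
    fix x assume "x \<in> \<Union> ?P"
    then obtain W where W: "W \<in> I" "big col W" "x \<in> W" by blast
    have "x \<notin> ?S"
    proof
      assume x: "x \<in> ?S"
      then have "{x} = W"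
        using disjointD[OF partition_onD2[OF part], of "{x}" W] W(1,3) by blast
      then show False using x W(2) big_singleton[of col x] by simp
    qed
    then show "x \<in> V - ?S" using sub[OF W(1)] W(3) by blast
  next
    fix x assume x: "x \<in> V - ?S"
    then obtain W where W: "W \<in> I" "x \<in> W" using cover by blast
    then have "big col W" using small[OF W(1)] x by blast
    then show "x \<in> \<Union> ?P" using W by blast
  qed
  moreover have "disjoint ?P"
    using partition_onD2[OF part] by (rule pairwise_subset) blast
  moreover have "{} \<notin> ?P" using partition_onD3[OF part] by blast
  ultimately have "partition_on (V - ?S) ?P" by (simp add: partition_on_def)
  moreover have "?S \<subseteq> V" using sub by blast
  ultimately show "split_blocks col I \<in> big_partitions col V"
    unfolding split_blocks_def big_partitions_def by blast
  have "?P \<union> (\<lambda>v. {v}) ` ?S = I" using small by blast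
  then show "join_blocks (split_blocks col I) = I"
    unfolding split_blocks_def join_blocks_def prod.case .
qed

text \<open>Blocks in \<open>P\<close> receive the colour \<open>None\<close>, and the one-element
  blocks from \<open>S\<close> keep their variable.\<close>

lemma gval_contraction_join_blocks:
  fixes col :: "'v \<Rightarrow> nat option"
  assumes V: "finite V" and SP: "(S, P) \<in> big_partitions col V"
  shows "gval f (contraction (coloured_graph col V) (join_blocks (S, P))) =
    gval f (complete_multipartite (exponent_partition (xtype col S) @ replicate (card P) 1))"
proof -
  note D = big_partitionsD[OF SP]
  let ?I = "P \<union> (\<lambda>v. {v}) ` S"
  have fS: "finite S" by (rule finite_subset[OF D(1) V])
  have fP: "finite P" by (rule finite_elements[OF _ D(2)]) (simp add: V)
  have disj: "P \<inter> (\<lambda>v. {v}) ` S = {}" using D(6) by blast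
  have bP: "block_colour col W = None" if "W \<in> P" for W
    using D(4)[OF that] by (simp add: block_colour_def)
  have "xtype (block_colour col) ?I = xtype (block_colour col) P + xtype (block_colour col) ((\<lambda>v. {v}) ` S)"
    unfolding xtype_def using fS by (intro sum.union_disjoint fP disj) simp
  also have "xtype (block_colour col) P = 0"
    unfolding xtype_def by (rule sum.neutral) (simp add: bP)
  also have "xtype (block_colour col) ((\<lambda>v. {v}) ` S) = xtype col S"
    unfolding xtype_def by (subst sum.reindex) (simp_all add: block_colour_singleton)
  finally have x: "xtype (block_colour col) ?I = xtype col S" by simp
  have "{W\<in>?I. block_colour col W = None} = P"
  proof (rule set_eqI)
    fix W
    have "block_colour col {v} \<noteq> None" if "v \<in> S" for v
      unfolding block_colour_singleton by (rule D(3)[OF that])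
    then show "W \<in> {W\<in>?I. block_colour col W = None} \<longleftrightarrow> W \<in> P" using bP[of W] by blast
  qed
  then have z: "ztype (block_colour col) ?I = card P" by (simp only: ztype_def)
  have "finite ?I" using fP fS by simp
  from gval_coloured_graph[OF this, of f "block_colour col", unfolded x z]
  show ?thesis
    using contraction_coloured_graph[OF tube_partition_join_blocks[OF SP]] by (simp only: join_blocks_def prod.case)
qed

lemma prod_join_blocks:
  fixes u :: "'v set \<Rightarrow> 'r::comm_monoid_mult"
  assumes V: "finite V" and SP: "(S, P) \<in> big_partitions col V" and u: "\<And>v. v \<in> S \<Longrightarrow> u {v} = 1"
  shows "prod u (join_blocks (S, P)) = prod u P"
proof -
  note D = big_partitionsD[OF SP]
  have "finite S" by (rule finite_subset[OF D(1) V])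
  moreover have "finite P" by (rule finite_elements[OF _ D(2)]) (simp add: V)
  ultimately have "prod u (P \<union> (\<lambda>v. {v}) ` S) = prod u P * prod u ((\<lambda>v. {v}) ` S)"
    using D(6) by (intro prod.union_disjoint) auto
  also have "prod u ((\<lambda>v. {v}) ` S) = 1" by (rule prod.neutral) (use u in blast)
  finally show ?thesis by (simp add: join_blocks_def)
qed

section \<open>Comparison of the two series over a fixed coloured set\<close>

lemma prod_zero_factor:
  fixes u :: "'i \<Rightarrow> 'r::{comm_ring, comm_monoid_mult}"
  assumes "finite A" "i \<in> A" "u i = 0"
  shows "prod u A = 0"
  using assms by (simp add: prod.remove[of A i])

lemma lab_zsubst_young_gf:
  assumes V: "finite V" and g: "connected_graphic g"
  shows "lab col (zsubst (young_gf f) (young_gf g)) V = lab col (young_gf (graphic_prod f g)) V"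
proof -
  let ?L = "\<lambda>S P. lab col (fps_const (nmult (fact (card P)) (fps_nth (young_gf f) (card P)))) S"
  let ?w = "\<lambda>P. \<Prod>W\<in>P. lab col (young_gf g) W"
  let ?T = "big_partitions col V"
  let ?A = "Sigma (Pow V) (\<lambda>S. {P. partition_on (V - S) P})"
  have finP: "finite P" if "partition_on (V - S) P" for S P
    by (rule finite_elements[OF _ that]) (simp add: V)
  have lab_W: "lab col (young_gf g) W = (if big col W then qemb (gval g (coloured_graph col W)) else 0)"
    if "W \<subseteq> V" for W
    by (rule lab_young_gf[OF finite_subset[OF that V]])
  have "lab col (zsubst (young_gf f) (young_gf g)) V = (\<Sum>S\<in>Pow V. \<Sum>P | partition_on (V - S) P. ?L S P * ?w P)"
    by (rule lab_zsubst[OF V young_gf_no_constant_term])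
  also have "\<dots> = (\<Sum>(S, P)\<in>?A. ?L S P * ?w P)"
    by (rule sum.Sigma) (use V in \<open>simp_all add: finitely_many_partition_on\<close>)
  also have "\<dots> = (\<Sum>(S, P)\<in>?T. ?L S P * ?w P)"
  \<comment> \<open>A pair outside \<open>?T\<close> has either a vertex coloured
    \<open>None\<close> in \<open>S\<close>, which kills the outer coefficient, or a block that is
    not big, which gives a zero factor.\<close>
  proof (rule sum.mono_neutral_right)
    show "finite ?A" using V by (intro finite_SigmaI) (simp_all add: finitely_many_partition_on)
    show "?T \<subseteq> ?A" by (auto simp: big_partitions_def)
    show "\<forall>p\<in>?A - ?T. (case p of (S, P) \<Rightarrow> ?L S P * ?w P) = 0"
    proof
      fix p assume p: "p \<in> ?A - ?T"
      obtain S P where SP: "p = (S, P)" by (cases p)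
      then have S: "S \<subseteq> V" and P: "partition_on (V - S) P" using p by auto
      have "\<not> ((\<forall>v\<in>S. col v \<noteq> None) \<and> (\<forall>W\<in>P. big col W))"
        using p S P unfolding SP big_partitions_def by blast
      then consider "\<not> (\<forall>v\<in>S. col v \<noteq> None)" | W where "W \<in> P" "\<not> big col W" by blast
      then have "?L S P * ?w P = 0"
      proof cases
        case 1
        then have "?L S P = 0" by (simp only: lab_const_young_gf[OF finite_subset[OF S V]] simp_thms if_False)
        then show ?thesis by simp
      next
        case 2
        have "W \<subseteq> V" using 2(1) P unfolding partition_on_def by blast
        then have "lab col (young_gf g) W = 0" using 2(2) by (simp add: lab_W)
        then have "?w P = 0" by (rule prod_zero_factor[OF finP[OF P] 2(1)])
        then show ?thesis by simp
      qed
      then show "(case p of (S, P) \<Rightarrow> ?L S P * ?w P) = 0" unfolding SP prod.case .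
    qed
  qed
  also have "\<dots> = lab col (young_gf (graphic_prod f g)) V"
  proof (cases "big col V")
    case False
    have "?L S P * ?w P = 0" if SP: "(S, P) \<in> ?T" for S P
    proof -
      note D = big_partitionsD[OF SP]
      \<comment> \<open>Subsets of a set that is not big are not big, so no block is available. Then
        \<open>S = V\<close>, and the outer coefficient belongs to a monomial free of
        \<open>z\<close> that the series omits.\<close>
      have "P = {}"
      proof (rule ccontr)
        assume "P \<noteq> {}"
        then obtain W where "W \<in> P" by blast
        then have "big col V" using big_mono[OF D(4)] D(5) by blast
        then show False using False by blast
      qed
      then have "S = V" using D(1) partition_onD1[OF D(2)] by auto
      then have "?L S P = 0"
        using False \<open>P = {}\<close> by (simp only: lab_const_young_gf[OF V] card.empty less_irrefl simp_thms if_False)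
      then show ?thesis by simp
    qed
    then have "(\<Sum>(S, P)\<in>?T. ?L S P * ?w P) = 0" by (intro sum.neutral) (simp add: case_prod_unfold)
    then show ?thesis using False by (simp add: lab_young_gf[OF V])
  next
    case True
    let ?G = "coloured_graph col V"
    let ?u = "\<lambda>W. qemb (gval g (induced ?G W))"
    have "(\<Sum>(S, P)\<in>?T. ?L S P * ?w P) =
        (\<Sum>I | tube_partition ?G I. qemb (gval f (contraction ?G I)) * (\<Prod>W\<in>I. ?u W))"
    proof (rule sum.reindex_bij_witness[of _ "split_blocks col" join_blocks])
      fix p assume p: "p \<in> ?T"
      obtain S P where SP: "p = (S, P)" by (cases p)
      note p = p[unfolded SP]
      note D = big_partitionsD[OF p]
      show "split_blocks col (join_blocks p) = p" unfolding SP by (rule split_join_blocks[OF p])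
      show "join_blocks p \<in> {I. tube_partition ?G I}"
        unfolding SP using tube_partition_join_blocks[OF p] by simp
      \<comment> \<open>This is the condition under which \<open>lab_const_young_gf\<close> gives a
        value of \<open>f\<close>: without blocks, \<open>S\<close> is all of \<open>V\<close>,
        which is big in this case.\<close>
      have "card P > 0 \<or> big col S"
      proof (cases "P = {}")
        case True
        then have "S = V" using D(1) partition_onD1[OF D(2)] by auto
        then show ?thesis using \<open>big col V\<close> by simp
      next
        case False
        then show ?thesis using finP[OF D(2)] by (simp add: card_gt_0_iff)
      qed
      then have "?L S P = qemb (gval f (contraction ?G (join_blocks p)))"
        unfolding SP gval_contraction_join_blocks[OF V p] lab_const_young_gf[OF finite_subset[OF D(1) V]]
        using D(3) by (intro if_P conjI ballI) simp_all
      moreover have "prod ?u (join_blocks p) = ?w P"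
      proof -
        have "?u {v} = 1" if "v \<in> S" for v
        proof -
          have "{v} \<subseteq> V" using D(1) that by blast
          then show ?thesis by (simp only: induced_coloured_graph gval_singleton[OF g] qfrac_one)
        qed
        then have "prod ?u (join_blocks p) = prod ?u P" unfolding SP by (rule prod_join_blocks[OF V p])
        also have "\<dots> = ?w P"
        proof (rule prod.cong)
          fix W assume W: "W \<in> P"
          then have "W \<subseteq> V" using D(5)[OF W] by blast
          then show "?u W = lab col (young_gf g) W"
            using D(4)[OF W] by (simp only: induced_coloured_graph lab_W if_True)
        qed simp
        finally show ?thesis .
      qed
      ultimately show "qemb (gval f (contraction ?G (join_blocks p))) * prod ?u (join_blocks p) =
          (case p of (S, P) \<Rightarrow> ?L S P * ?w P)"
        by (simp only: SP prod.case)
    qed (use split_blocks_big_partitions in blast)+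
    also have "\<dots> = qemb (gval (graphic_prod f g) ?G)"
      using g by (simp only: gval_graphic_prod[OF pair_graph_coloured_graph[OF V]] connected_graphic_def qemb_sum qemb_mult qemb_prod)
    finally show ?thesis using True by (simp only: lab_young_gf[OF V] if_True)
  qed
  finally show ?thesis .
qed

theorem theorem2p2p15:
  fixes f g :: "nat pair_pre_digraph \<Rightarrow> 'k::{comm_ring, comm_monoid_mult}"
  assumes "connected_graphic f" and "connected_graphic g"
  shows "young_gf (graphic_prod f g) = zsubst (young_gf f) (young_gf g)"
proof (rule fps_ext, rule xseries_eqI)
  fix n :: nat and \<alpha> :: "nat \<Rightarrow>\<^sub>0 nat"
  \<comment> \<open>A coloured set realising the given monomial, with \<open>fst\<close> as
    colouring: as many pairs starting with \<open>Some i\<close> as the exponent of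
    \<open>x_i\<close>, and \<open>n\<close> pairs starting with \<open>None\<close>.\<close>
  let ?X = "Sigma (Poly_Mapping.keys \<alpha>) (\<lambda>i. {..<Poly_Mapping.lookup \<alpha> i})"
  let ?V = "map_prod Some id ` ?X \<union> Pair None ` {..<n}"
  have V: "finite ?V" by (intro finite_UnI finite_imageI finite_SigmaI) simp_all
  have z: "ztype fst ?V = n"
  proof -
    have "{v\<in>?V. fst v = None} = Pair None ` {..<n}" by auto
    then show ?thesis unfolding ztype_def by (simp add: card_image inj_on_def)
  qed
  have x: "xtype fst ?V = \<alpha>"
  proof (rule poly_mapping_eqI)
    fix i
    have "{v\<in>?V. fst v = Some i} = Pair (Some i) ` {..<Poly_Mapping.lookup \<alpha> i}"
      by (auto simp: in_keys_iff image_iff)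
    then show "Poly_Mapping.lookup (xtype fst ?V) i = Poly_Mapping.lookup \<alpha> i"
      unfolding lookup_xtype[OF V] by (simp add: card_image inj_on_def)
  qed
  from lab_zsubst_young_gf[OF V assms(2), of fst f]
  have "nmult (xfact \<alpha> * fact n) (xcoeff (fps_nth (zsubst (young_gf f) (young_gf g)) n) \<alpha>) =
      nmult (xfact \<alpha> * fact n) (xcoeff (fps_nth (young_gf (graphic_prod f g)) n) \<alpha>)"
    unfolding lab_def x z .
  then show "xcoeff (fps_nth (young_gf (graphic_prod f g)) n) \<alpha> =
      xcoeff (fps_nth (zsubst (young_gf f) (young_gf g)) n) \<alpha>"
    by (rule nmult_cancel_rationalized[OF _ sym, rotated]) (simp add: xfact_pos)
qed

end
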